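(* Index the edges of every triangle $K\in\mathcal T_h$ so that $l_K^{(1)}\ge l_K^{(2)}\ge l_K^{(3)}$ and set $$w_i=\frac{2l_K^{(i)}}{3(l_K^{(1)}+l_K^{(2)})},\qquad\mathcal C_{K,1}=\frac{2}{3(l_K^{(1)}+l_K^{(2)})}.$$ (Systems.) Consider a hyperbolic system of conservation laws $\bm u_t+\nabla\cdot\bm F(\bm u)=\bm 0$ with invariant region $\mathcal G$, satisfying the weak LF property. Suppose that the piecewise $\mathbb P^1$ solution $\bm u_h^n$ at time $t^n$ satisfies $\bm u^{\rm int}_{i,\nu},\bm u^{\rm ext}_{i,\nu}\in\mathcal G$ for all $i,\nu,K$, and in addition $\bm u_K^*\in\mathcal G$ for all $K$ with $\sum_iw_i\ne1$. Then the $\mathbb P^1$-based scheme with the LF flux and viscosity coefficient $\alpha\ge\alpha^{\rm wLF}$ is bound-preserving (BP), i.e. $\bar{\bm u}_K^{n+1}\in\mathcal G$ for all $K$, under the CFL condition $$\alpha\frac{\Delta t}{|K|}\le\mathcal C_{K,1}\qquad\forall K\in\mathcal T_h.$$ (Scalar.) For a scalar conservation law $u_t+\nabla\cdot\bm F(u)=0$ with $\mathcal G=[u_{\min},u_{\max}]$, the same conclusion holds under the same CFL condition, with the analogous hypothesis on $u_h^n$ and with $\alpha\ge\alpha^{\rm LF}$. Moreover, this BP CFL condition cannot be improved by selecting another feasible convex decomposition: for every $K$ and every convex decomposition on $K$ feasible for $\mathbb P^1$ with edge weights $\tilde w_i$, $\min_i\tilde w_i/l_K^{(i)}\le\mathcal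 C_{K,1}$.
   Context: **Mesh.** $\mathcal T_h$ is a triangulation of $\Omega\subset\mathbb R^2$; for $K\in\mathcal T_h$, $e_K^{(i)}$ ($i=1,2,3$) are the edges, $l_K^{(i)}$ their lengths, $\bm n_K^{(i)}$ the outward unit normals, $|K|$ the area. $\bm F=(\bm f_1,\bm f_2)$, $\bm F(\bm u)\cdot\bm n=n^1\bm f_1(\bm u)+n^2\bm f_2(\bm u)$. **Scheme.** $\bm u_h^n$ is polynomial of degree $\le k$ (here $k=1$) on each $K$, with cell averages $\bar{\bm u}_K^n$. $(x_K^{(i),\nu},y_K^{(i),\nu})$, $\omega_\nu^{\tt G}$, $\nu=1,\dots,Q$, are the nodes and weights of the $Q=k+1$ point Gauss quadrature on $e_K^{(i)}$, with $\sum_\nu\omega^{\tt G}_\nu=1$. $\bm u^{\rm int}_{i,\nu}$ and $\bm u^{\rm ext}_{i,\nu}$ are the values at this node of $\bm u_h^n$ from inside $K$ and from the neighbouring cell across $e_K^{(i)}$. The scheme (LF flux, forward Euler) is $$\bar{\bm u}_K^{n+1}=\bar{\bm u}_K^n-\frac{\Delta t}{2|K|}\sum_{i=1}^3l_K^{(i)}\sum_{\nu=1}^Q\omega_\nu^{\tt G}\big[\bm F(\bm u^{\rm int}_{i,\nu})\cdot\bm n_K^{(i)}+\bm F(\bm u^{\rm ext}_{i,\nu})\cdot\bm n_K^{(i)}+\alpha\bm u^{\rm int}_{i,\nu}-\alpha\bm u^{\rm ext}_{i,\nu}\big]$$ (and the same formula in the scalar case). For $\sum_iw_i\neq1$, $$\bm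 u_K^*=\frac{\bar{\bm u}_K^n-\sum_{i=1}^3w_i\sum_{\nu=1}^Q\omega_\nu^{\tt G}\bm u^{\rm int}_{i,\nu}}{1-\sum_{i=1}^3w_i}.$$ **Scalar case.** $u_{\min}$, $u_{\max}$ are the minimum and maximum of the initial datum, and $\alpha^{\rm LF}=\max|\bm F'(u_h(\bm x))\cdot\bm n_K^{(i)}|$ over $\bm x\in e_K^{(i)}$, $i\in\{1,2,3\}$, $K\in\mathcal T_h$ (both one-sided values of $u_h$ on the edges are included). **System case.** $\mathcal G=\{\bm u\in\mathbb R^d:g_j(\bm u)\succ0\ \forall j\in\mathbb J\cup\hat{\mathbb J}\}$, where $\succ$ means $>$ for $j\in\mathbb J$ and $\ge$ for $j\in\hat{\mathbb J}$. It is a standing assumption that $\mathcal G$ equals its GQL representation $$\mathcal G^\star=\{\bm u\in\mathbb R^d:(\bm u-\bm u^\star_j)\cdot\mathbf n^\star_j\succ0\ \ \forall\bm u^\star_j\in\mathcal S_j,\ \forall j\in\mathbb J\cup\hat{\mathbb J}\},$$ with $\mathbf n^\star_j=\nabla g_j(\bm u^\star_j)$, $\mathcal S_j=\partial\mathcal G\cap\partial\mathcal G_j$, $\mathcal G_j=\{\bm u:g_j(\bm u)\succ0\}$. *Weak LF property*: for any unit $\bm n\in\mathbb R^2$ and any $\bm u\in\mathcal G$ there exist $\tilde\alpha(\bm u,\bm n)>0$ and $\bm\zeta(\bm u^\star)\in\mathbb R^2$ ($\bm\zeta$ depending only on $\bm u^\star$, not on $\bm u,\bm n$) such that $$\tilde\alpha(\bm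 u,\bm n)(\bm u-\bm u^\star)\cdot\mathbf n^\star_j-(\bm F(\bm u)\cdot\bm n)\cdot\mathbf n_j^\star\succ\bm\zeta(\bm u^\star)\cdot\bm n\qquad\forall\bm u^\star\in\mathcal S_j,\ \forall j.$$ $\alpha^{\rm wLF}=\max\tilde\alpha(\bm u_h(\bm x),\bm n_K^{(i)})$ over $\bm x\in e_K^{(i)}$, $i\in\{1,2,3\}$, $K\in\mathcal T_h$ (both one-sided values included). **Feasible convex decomposition.** An identity $\frac1{|K|}\iint_Kp\,dx\,dy=\sum_{i=1}^3\frac{w_i}{l_K^{(i)}}\int_{e_K^{(i)}}p\,ds+\sum_{s=1}^S\omega_sp(\xi_s,\eta_s)$ is feasible for $\mathbb P^k$ (polynomials of total degree $\le k$) if it holds for all $p\in\mathbb P^k$, all weights $w_i,\omega_s$ are positive and sum to one, and all nodes $(\xi_s,\eta_s)$ lie in $K$.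
   Formalization: In the scalar case the maximum defining α^LF runs, on each K, over the smallest interval containing all one-sided edge values of u_h on K (with each normal of K), not only the values attained on the same edge; with attained values only, the scalar claim is false. *)

theory Defs
  imports "HOL-Analysis.Analysis" "HOL-Computational_Algebra.Polynomial"
begin

text \<open>
  A triangle is given by a labelling \<open>v\<close> of its vertices by \<open>1, 2, 3\<close>. The edge with index \<open>i\<close> is
  the one opposite to \<open>v i\<close>, so labelling the edges is the same as labelling the vertices.
\<close>

definition tri :: "(nat \<Rightarrow> real^2) \<Rightarrow> (real^2) set" where
  "tri v = convex hull (v ` {1..3})"

definition edge_path :: "(nat \<Rightarrow> real^2) \<Rightarrow> nat \<Rightarrow> real \<Rightarrow> real^2" where
  "edge_path v i = linepath (v (i mod 3 + 1)) (v ((i + 1) mod 3 + 1))"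

definition edge :: "(nat \<Rightarrow> real^2) \<Rightarrow> nat \<Rightarrow> (real^2) set" where
  "edge v i = closed_segment (v (i mod 3 + 1)) (v ((i + 1) mod 3 + 1))"

definition edge_length :: "(nat \<Rightarrow> real^2) \<Rightarrow> nat \<Rightarrow> real" where
  "edge_length v i = dist (v (i mod 3 + 1)) (v ((i + 1) mod 3 + 1))"

definition edge_integral :: "(nat \<Rightarrow> real^2) \<Rightarrow> nat \<Rightarrow> (real^2 \<Rightarrow> real) \<Rightarrow> real" where
  "edge_integral v i p = edge_length v i * integral {0..1} (\<lambda>t. p (edge_path v i t))"

definition outward_normal :: "(nat \<Rightarrow> real^2) \<Rightarrow> nat \<Rightarrow> real^2" where
  "outward_normal v i = (THE n. norm n = 1 \<and>
     (\<forall>x\<in>edge v i. \<forall>y\<in>edge v i. n \<bullet> (x - y) = 0) \<and>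
     (\<forall>x\<in>tri v. \<forall>y\<in>edge v i. n \<bullet> (x - y) \<le> 0))"

abbreviation area :: "(real^2) set \<Rightarrow> real" where
  "area K \<equiv> measure lebesgue K"

definition cell_average :: "(real^2) set \<Rightarrow> (real^2 \<Rightarrow> 'u::euclidean_space) \<Rightarrow> 'u" where
  "cell_average K p = (1 / area K) *\<^sub>R integral K p"

text \<open>
  A conforming triangulation of \<open>\<Omega>\<close> together with a labelling of each cell by nonincreasing
  edge lengths.
\<close>

definition sorted_mesh ::
  "(real^2) set \<Rightarrow> (real^2) set set \<Rightarrow> ((real^2) set \<Rightarrow> nat \<Rightarrow> real^2) \<Rightarrow> bool" where
  "sorted_mesh \<Omega> T vtx \<longleftrightarrow> triangulation T \<and> \<Union>T = closure \<Omega> \<and>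
     (\<forall>K\<in>T. K = tri (vtx K) \<and> \<not> collinear (vtx K ` {1..3}) \<and>
        edge_length (vtx K) 1 \<ge> edge_length (vtx K) 2 \<and>
        edge_length (vtx K) 2 \<ge> edge_length (vtx K) 3)"

definition polys :: "nat \<Rightarrow> (real^2 \<Rightarrow> 'u::real_vector) set" where
  "polys k = {p. \<exists>c. \<forall>z. p z = (\<Sum>i\<le>k. \<Sum>j\<le>k - i. ((z $ 1) ^ i * (z $ 2) ^ j) *\<^sub>R c i j)}"

text \<open>
  \<open>Q\<close>-point Gauss quadrature on \<open>[0,1]\<close>, characterised (up to the order of the nodes) by its
  degree of exactness \<open>2Q - 1\<close>. The weights are normalised to sum up to one.
\<close>

definition gauss_rule :: "nat \<Rightarrow> (nat \<Rightarrow> real) \<Rightarrow> (nat \<Rightarrow> real) \<Rightarrow> bool" where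
  "gauss_rule Q \<tau> \<omega> \<longleftrightarrow> inj_on \<tau> {1..Q} \<and> \<tau> ` {1..Q} \<subseteq> {0..1} \<and>
     (\<forall>p::real poly. degree p < 2 * Q \<longrightarrow>
        (\<Sum>\<nu>=1..Q. \<omega> \<nu> * poly p (\<tau> \<nu>)) = integral {0..1} (poly p))"

definition feasible_decomposition ::
  "nat \<Rightarrow> (nat \<Rightarrow> real^2) \<Rightarrow> (nat \<Rightarrow> real) \<Rightarrow> nat \<Rightarrow> (nat \<Rightarrow> real) \<Rightarrow> (nat \<Rightarrow> real^2) \<Rightarrow> bool" where
  "feasible_decomposition k v w S \<omega> \<xi> \<longleftrightarrow>
     (\<forall>p\<in>polys k. cell_average (tri v) p =
        (\<Sum>i=1..3. w i / edge_length v i * edge_integral v i p) + (\<Sum>s=1..S. \<omega> s * p (\<xi> s))) \<and>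
     (\<forall>i\<in>{1..3}. w i > 0) \<and> (\<forall>s\<in>{1..S}. \<omega> s > 0) \<and>
     (\<Sum>i=1..3. w i) + (\<Sum>s=1..S. \<omega> s) = 1 \<and>
     (\<forall>s\<in>{1..S}. \<xi> s \<in> tri v)"

definition cfl_const :: "(nat \<Rightarrow> real^2) \<Rightarrow> real" where
  "cfl_const v = 2 / (3 * (edge_length v 1 + edge_length v 2))"

definition edge_weight :: "(nat \<Rightarrow> real^2) \<Rightarrow> nat \<Rightarrow> real" where
  "edge_weight v i = 2 * edge_length v i / (3 * (edge_length v 1 + edge_length v 2))"

definition flux_dot :: "('u \<Rightarrow> 'u) \<Rightarrow> ('u \<Rightarrow> 'u) \<Rightarrow> 'u::real_vector \<Rightarrow> real^2 \<Rightarrow> 'u" where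
  "flux_dot f1 f2 u n = (n $ 1) *\<^sub>R f1 u + (n $ 2) *\<^sub>R f2 u"

text \<open>
  A piecewise function is a family \<open>u\<close> indexed by the cells. On edges without a neighbouring cell
  the exterior trace is arbitrary boundary data \<open>ub\<close> (ghost values, periodic continuation, ...).
\<close>

definition int_trace ::
  "((real^2) set \<Rightarrow> real^2 \<Rightarrow> 'u) \<Rightarrow> (real^2) set \<Rightarrow> real^2 \<Rightarrow> 'u" where
  "int_trace u K x = u K x"

definition ext_trace ::
  "(real^2) set set \<Rightarrow> ((real^2) set \<Rightarrow> nat \<Rightarrow> real^2) \<Rightarrow> ((real^2) set \<Rightarrow> real^2 \<Rightarrow> 'u) \<Rightarrow>
   ((real^2) set \<Rightarrow> real^2 \<Rightarrow> 'u) \<Rightarrow> (real^2) set \<Rightarrow> nat \<Rightarrow> real^2 \<Rightarrow> 'u" where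
  "ext_trace T vtx u ub K i x =
     (if \<exists>K'\<in>T - {K}. edge (vtx K) i edge_of K'
      then u (THE K'. K' \<in> T - {K} \<and> edge (vtx K) i edge_of K') x
      else ub (edge (vtx K) i) x)"

definition edge_values ::
  "(real^2) set set \<Rightarrow> ((real^2) set \<Rightarrow> nat \<Rightarrow> real^2) \<Rightarrow> ((real^2) set \<Rightarrow> real^2 \<Rightarrow> 'u) \<Rightarrow>
   ((real^2) set \<Rightarrow> real^2 \<Rightarrow> 'u) \<Rightarrow> (real^2) set \<Rightarrow> nat \<Rightarrow> 'u set" where
  "edge_values T vtx u ub K i =
     int_trace u K ` edge (vtx K) i \<union> ext_trace T vtx u ub K i ` edge (vtx K) i"

text \<open>\<open>\<tau>\<close> and \<open>\<omega>\<close> are the nodes and weights of the reference quadrature rule on \<open>[0,1]\<close>.\<close>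

definition next_average ::
  "(real^2) set set \<Rightarrow> ((real^2) set \<Rightarrow> nat \<Rightarrow> real^2) \<Rightarrow> nat \<Rightarrow> (nat \<Rightarrow> real) \<Rightarrow> (nat \<Rightarrow> real) \<Rightarrow>
   ('u \<Rightarrow> 'u) \<Rightarrow> ('u \<Rightarrow> 'u) \<Rightarrow> real \<Rightarrow> real \<Rightarrow>
   ((real^2) set \<Rightarrow> real^2 \<Rightarrow> 'u) \<Rightarrow> ((real^2) set \<Rightarrow> real^2 \<Rightarrow> 'u) \<Rightarrow>
   (real^2) set \<Rightarrow> 'u::euclidean_space" where
  "next_average T vtx Q \<tau> \<omega> f1 f2 \<alpha> dt u ub K =
     cell_average K (u K) - (dt / (2 * area K)) *\<^sub>R
       (\<Sum>i=1..3. edge_length (vtx K) i *\<^sub>R (\<Sum>\<nu>=1..Q. \<omega> \<nu> *\<^sub>R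
          (let x = edge_path (vtx K) i (\<tau> \<nu>); n = outward_normal (vtx K) i;
               ui = int_trace u K x; ue = ext_trace T vtx u ub K i x
           in flux_dot f1 f2 ui n + flux_dot f1 f2 ue n + \<alpha> *\<^sub>R ui - \<alpha> *\<^sub>R ue)))"

definition star_value ::
  "((real^2) set \<Rightarrow> nat \<Rightarrow> real^2) \<Rightarrow> nat \<Rightarrow> (nat \<Rightarrow> real) \<Rightarrow> (nat \<Rightarrow> real) \<Rightarrow>
   ((real^2) set \<Rightarrow> real^2 \<Rightarrow> 'u) \<Rightarrow> (real^2) set \<Rightarrow> 'u::euclidean_space" where
  "star_value vtx Q \<tau> \<omega> u K =
     (1 / (1 - (\<Sum>i=1..3. edge_weight (vtx K) i))) *\<^sub>R
       (cell_average K (u K) - (\<Sum>i=1..3. edge_weight (vtx K) i *\<^sub>R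
          (\<Sum>\<nu>=1..Q. \<omega> \<nu> *\<^sub>R int_trace u K (edge_path (vtx K) i (\<tau> \<nu>)))))"

definition solution_admissible ::
  "(real^2) set set \<Rightarrow> ((real^2) set \<Rightarrow> nat \<Rightarrow> real^2) \<Rightarrow> nat \<Rightarrow> (nat \<Rightarrow> real) \<Rightarrow> (nat \<Rightarrow> real) \<Rightarrow>
   'u::euclidean_space set \<Rightarrow> ((real^2) set \<Rightarrow> real^2 \<Rightarrow> 'u) \<Rightarrow> ((real^2) set \<Rightarrow> real^2 \<Rightarrow> 'u) \<Rightarrow> bool" where
  "solution_admissible T vtx Q \<tau> \<omega> G u ub \<longleftrightarrow>
     (\<forall>K\<in>T. \<forall>i\<in>{1..3}. \<forall>\<nu>\<in>{1..Q}.
        int_trace u K (edge_path (vtx K) i (\<tau> \<nu>)) \<in> G \<and>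
        ext_trace T vtx u ub K i (edge_path (vtx K) i (\<tau> \<nu>)) \<in> G) \<and>
     (\<forall>K\<in>T. (\<Sum>i=1..3. edge_weight (vtx K) i) \<noteq> 1 \<longrightarrow> star_value vtx Q \<tau> \<omega> u K \<in> G)"

definition succ_rel :: "'j set \<Rightarrow> 'j \<Rightarrow> real \<Rightarrow> real \<Rightarrow> bool" where
  "succ_rel J j a b \<longleftrightarrow> (if j \<in> J then a > b else a \<ge> b)"

definition constraint_set :: "'j set \<Rightarrow> ('j \<Rightarrow> 'u \<Rightarrow> real) \<Rightarrow> 'j \<Rightarrow> 'u set" where
  "constraint_set J g j = {u. succ_rel J j (g j u) 0}"

definition region :: "'j set \<Rightarrow> 'j set \<Rightarrow> ('j \<Rightarrow> 'u \<Rightarrow> real) \<Rightarrow> 'u set" where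
  "region J Jh g = {u. \<forall>j\<in>J \<union> Jh. succ_rel J j (g j u) 0}"

definition boundary_part ::
  "'j set \<Rightarrow> 'j set \<Rightarrow> ('j \<Rightarrow> 'u::euclidean_space \<Rightarrow> real) \<Rightarrow> 'j \<Rightarrow> 'u set" where
  "boundary_part J Jh g j = frontier (region J Jh g) \<inter> frontier (constraint_set J g j)"

definition gradient :: "('u::euclidean_space \<Rightarrow> real) \<Rightarrow> 'u \<Rightarrow> 'u" where
  "gradient g u = (THE D. GDERIV g u :> D)"

definition gql_region ::
  "'j set \<Rightarrow> 'j set \<Rightarrow> ('j \<Rightarrow> 'u::euclidean_space \<Rightarrow> real) \<Rightarrow> 'u set" where
  "gql_region J Jh g = {u. \<forall>j\<in>J \<union> Jh. \<forall>us\<in>boundary_part J Jh g j.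
     succ_rel J j ((u - us) \<bullet> gradient (g j) us) 0}"

definition weak_LF ::
  "'j set \<Rightarrow> 'j set \<Rightarrow> ('j \<Rightarrow> 'u::euclidean_space \<Rightarrow> real) \<Rightarrow> ('u \<Rightarrow> 'u) \<Rightarrow> ('u \<Rightarrow> 'u) \<Rightarrow>
   ('u \<Rightarrow> real^2 \<Rightarrow> real) \<Rightarrow> ('u \<Rightarrow> real^2) \<Rightarrow> bool" where
  "weak_LF J Jh g f1 f2 a \<zeta> \<longleftrightarrow> (\<forall>n u. norm n = 1 \<longrightarrow> u \<in> region J Jh g \<longrightarrow>
     a u n > 0 \<and>
     (\<forall>j\<in>J \<union> Jh. \<forall>us\<in>boundary_part J Jh g j.
        succ_rel J j (a u n * ((u - us) \<bullet> gradient (g j) us)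
                        - flux_dot f1 f2 u n \<bullet> gradient (g j) us) (\<zeta> us \<bullet> n)))"

text \<open>
  Differentiability is not required on the boundary of \<open>G\<close>, where fluxes may be singular.
\<close>

definition hyperbolic_on ::
  "'u::euclidean_space set \<Rightarrow> ('u \<Rightarrow> 'u) \<Rightarrow> ('u \<Rightarrow> 'u) \<Rightarrow> bool" where
  "hyperbolic_on G f1 f2 \<longleftrightarrow> (\<forall>u\<in>interior G.
     f1 differentiable (at u) \<and> f2 differentiable (at u) \<and>
     (\<forall>n::real^2. norm n = 1 \<longrightarrow> (\<exists>B. span B = UNIV \<and> (\<forall>b\<in>B. \<exists>c::real.
        (n $ 1) *\<^sub>R frechet_derivative f1 (at u) b + (n $ 2) *\<^sub>R frechet_derivative f2 (at u) b
          = c *\<^sub>R b))))"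

text \<open>
  Both coefficients are suprema in the extended reals, so that nothing has to be assumed about
  the maxima being attained. Traces may leave \<open>G\<close> away from the quadrature nodes, whereas the
  coefficient \<open>a\<close> of the weak LF property is only given on \<open>G\<close>; hence the intersection with \<open>G\<close>.
\<close>

definition alpha_wLF ::
  "(real^2) set set \<Rightarrow> ((real^2) set \<Rightarrow> nat \<Rightarrow> real^2) \<Rightarrow> 'u set \<Rightarrow> ('u \<Rightarrow> real^2 \<Rightarrow> real) \<Rightarrow>
   ((real^2) set \<Rightarrow> real^2 \<Rightarrow> 'u) \<Rightarrow> ((real^2) set \<Rightarrow> real^2 \<Rightarrow> 'u) \<Rightarrow> ereal" where
  "alpha_wLF T vtx G a u ub =
     (SUP K\<in>T. SUP i\<in>{1..3}. SUP v\<in>edge_values T vtx u ub K i \<inter> G.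
        ereal (a v (outward_normal (vtx K) i)))"

text \<open>
  In the scalar case the supremum runs over the smallest interval containing all one-sided
  values on the edges of \<open>K\<close>. Only taking the attained values is not sufficient: for piecewise
  constant data with values \<open>0\<close> and \<open>1\<close> and the flux \<open>f1 v = 3 * v^2 - 2 * v^3\<close>, \<open>f2 v = 0\<close>, this
  would give the coefficient \<open>0\<close>, and the scheme would not be bound-preserving.
\<close>

definition alpha_LF ::
  "(real^2) set set \<Rightarrow> ((real^2) set \<Rightarrow> nat \<Rightarrow> real^2) \<Rightarrow> (real \<Rightarrow> real) \<Rightarrow> (real \<Rightarrow> real) \<Rightarrow>
   ((real^2) set \<Rightarrow> real^2 \<Rightarrow> real) \<Rightarrow> ((real^2) set \<Rightarrow> real^2 \<Rightarrow> real) \<Rightarrow> ereal" where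
  "alpha_LF T vtx f1 f2 u ub =
     (SUP K\<in>T. SUP i\<in>{1..3}. SUP v\<in>convex hull (\<Union>m\<in>{1..3}. edge_values T vtx u ub K m).
        ereal \<bar>flux_dot (deriv f1) (deriv f2) v (outward_normal (vtx K) i)\<bar>)"

end

theory Submission
  imports Defs
begin

text \<open>
  With \<open>C\<close> the CFL constant and \<open>W = \<Sum>i. w\<^sub>i\<close>, the chosen weights are \<open>w\<^sub>i = C l\<^sub>i\<close>. The old cell average
  is \<open>(1 - W) u\<^sup>*\<close> plus \<open>w\<^sub>i\<close> times the quadrature means of the interior traces on the edges \<open>i\<close>. For
  \<open>W \<noteq> 1\<close> this is the definition of \<open>u\<^sup>*\<close>. As the edges are sorted, \<open>W = 1\<close> forces the triangle to be
  equilateral, and then it holds because all three weights are \<open>1/3\<close> and both the mean over the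
  triangle and the mean of the edge midpoint values are the value at the centroid
  (\<open>cell_average_splitting\<close>).

  Test one step of the scheme against a covector \<open>N\<close> at a point \<open>u\<^sub>0\<close>, and put \<open>\<lambda> = \<Delta>t / |K|\<close>. Since
  the outward normals scaled by the edge lengths add up to zero, any \<open>\<zeta> \<bullet> n\<^sub>i\<close> can be subtracted
  from the fluxes through the edges \<open>i\<close> without changing the scheme. What results is
  \<open>(1 - W) (u\<^sup>* - u\<^sub>0) \<bullet> N\<close> plus a combination, with positive coefficients, of
  \<open>(C - \<alpha> \<lambda>) (u - u\<^sub>0) \<bullet> N\<close> over the interior traces and of
  \<open>\<alpha> (u - u\<^sub>0) \<bullet> N - (F(u) \<bullet> n\<^sub>i) \<bullet> N - \<zeta> \<bullet> n\<^sub>i\<close> over all traces \<open>u\<close>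
  (\<open>next_average_splitting\<close>). The CFL condition makes the first kind of term nonnegative
  as soon as \<open>(u - u\<^sub>0) \<bullet> N \<ge> 0\<close>.

  For systems, the second kind of term is what the weak LF property controls, for every boundary
  point \<open>u\<^sub>0\<close> and its normal \<open>N\<close>, and the GQL representation turns these linear inequalities into
  membership in the invariant region. For scalar laws, \<open>u\<^sub>0\<close> is the smallest or the largest of the
  traces at the quadrature nodes, \<open>N = 1\<close> or \<open>N = -1\<close>, and \<open>\<zeta>\<close> is given by \<open>- N F(u\<^sub>0)\<close>; then the
  second kind of term is nonnegative by the mean value theorem.

  Optimality follows by inserting the barycentric coordinate of the vertex opposite to the
  shortest edge into a feasible decomposition (\<open>feasible_decomposition_bound\<close>).
\<close>

section \<open>Affine functions on a triangle\<close>

lemma sum_three: "(\<Sum>i=1..3. f i) = f 1 + f 2 + f (3::nat)" for f :: "nat \<Rightarrow> 'a::comm_monoid_add"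
  by (simp add: numeral_eq_Suc add.assoc)

lemma sum_two: "(\<Sum>i=1..2. f i) = f 1 + f (2::nat)" for f :: "nat \<Rightarrow> 'a::comm_monoid_add"
  by (simp add: numeral_eq_Suc)

lemma one_to_three: "{1..3::nat} = {1, 2, 3}"
  by auto

lemma polys_1_iff_affine:
  fixes p :: "real^2 \<Rightarrow> 'u::euclidean_space"
  shows "p \<in> polys 1 \<longleftrightarrow> (\<exists>c h. linear h \<and> p = (\<lambda>z. c + h z))"
proof
  assume "p \<in> polys 1"
  then obtain C where C: "\<And>z. p z = (\<Sum>i\<le>1. \<Sum>j\<le>1 - i. ((z $ 1) ^ i * (z $ 2) ^ j) *\<^sub>R C i j)"
    by (auto simp: polys_def)
  have "linear (\<lambda>z::real^2. (z $ 2) *\<^sub>R C 0 1 + (z $ 1) *\<^sub>R C 1 0)"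
    by (auto intro!: linearI simp: algebra_simps)
  moreover have "p = (\<lambda>z. C 0 0 + ((z $ 2) *\<^sub>R C 0 1 + (z $ 1) *\<^sub>R C 1 0))"
    by (rule ext) (simp add: C add.assoc)
  ultimately show "\<exists>c h. linear h \<and> p = (\<lambda>z. c + h z)" by blast
next
  assume "\<exists>c h. linear h \<and> p = (\<lambda>z. c + h z)"
  then obtain c h where h: "linear h" and p: "p = (\<lambda>z. c + h z)" by blast
  define C where "C i j = (if i = (0::nat) then if j = (0::nat) then c else h (axis 2 1)
    else h (axis 1 1))" for i j
  have "p z = (\<Sum>i\<le>1. \<Sum>j\<le>1 - i. ((z $ 1) ^ i * (z $ 2) ^ j) *\<^sub>R C i j)" for z
  proof -
    have "z = (z $ 1) *\<^sub>R axis 1 1 + (z $ 2) *\<^sub>R axis 2 1"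
      by (simp add: vec_eq_iff forall_2 axis_def)
    then have "h z = h ((z $ 1) *\<^sub>R axis 1 1 + (z $ 2) *\<^sub>R axis 2 1)" by (rule arg_cong)
    also have "\<dots> = (z $ 1) *\<^sub>R h (axis 1 1) + (z $ 2) *\<^sub>R h (axis 2 1)"
      by (simp only: linear_add[OF h] linear_scale[OF h])
    finally have "h z = (z $ 1) *\<^sub>R h (axis 1 1) + (z $ 2) *\<^sub>R h (axis 2 1)" .
    then show ?thesis by (simp add: p C_def)
  qed
  then show "p \<in> polys 1" unfolding polys_def by blast
qed

definition cross2 :: "real^2 \<Rightarrow> real^2 \<Rightarrow> real" where
  "cross2 x y = x $ 1 * y $ 2 - x $ 2 * y $ 1"

text \<open>Twice the signed area, hence the sign is the orientation of the labelling.\<close>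

definition tri_det :: "(nat \<Rightarrow> real^2) \<Rightarrow> real" where
  "tri_det v = cross2 (v 2 - v 1) (v 3 - v 1)"

lemma tri_det_edge:
  assumes "i \<in> {1..3}"
  shows "cross2 (v ((i + 1) mod 3 + 1) - v (i mod 3 + 1)) (v i - v (i mod 3 + 1)) = tri_det v"
  using assms unfolding one_to_three
  by (auto simp: tri_det_def cross2_def algebra_simps simp del: One_nat_def)

lemma tri_det_nonzero:
  assumes "\<not> collinear (v ` {1..3})"
  shows "tri_det v \<noteq> 0"
proof
  assume D: "tri_det v = 0"
  let ?x = "v 2 - v 1" and ?y = "v 3 - v 1"
  have "(?x \<bullet> ?y)\<^sup>2 + (tri_det v)\<^sup>2 = (norm ?x * norm ?y)\<^sup>2"
    unfolding power_mult_distrib power2_norm_eq_inner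
    by (simp add: tri_det_def cross2_def inner_vec_def sum_2 power2_eq_square algebra_simps)
  then have "\<bar>?x \<bullet> ?y\<bar> = norm ?x * norm ?y"
    using D power2_eq_iff_nonneg[of "\<bar>?x \<bullet> ?y\<bar>" "norm ?x * norm ?y"] by (simp only: power2_abs) simp
  then have "collinear {0, ?x, ?y}" by (simp only: norm_cauchy_schwarz_equal)
  then have "collinear {v 2, v 1, v 3}" by (subst collinear_3) simp
  moreover have "v ` {1..3} = {v 2, v 1, v 3}" by (simp only: one_to_three) auto
  ultimately show False using assms by simp
qed

text \<open>The barycentric coordinate belonging to the vertex \<open>v i\<close>, as a quotient of signed areas.\<close>

definition bary :: "(nat \<Rightarrow> real^2) \<Rightarrow> nat \<Rightarrow> real^2 \<Rightarrow> real" where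
  "bary v i x =
     cross2 (v ((i + 1) mod 3 + 1) - v (i mod 3 + 1)) (x - v (i mod 3 + 1)) / tri_det v"

lemma bary_vertex:
  assumes "tri_det v \<noteq> 0" "i \<in> {1..3}" "j \<in> {1..3}"
  shows "bary v i (v j) = (if i = j then 1 else 0)"
  using assms tri_det_edge[of i v] unfolding one_to_three
  by (auto simp: bary_def cross2_def algebra_simps simp del: One_nat_def)

lemma bary_affine: "\<exists>c h. linear h \<and> bary v i = (\<lambda>x. c + h x)"
proof -
  let ?a = "v (i mod 3 + 1)" and ?b = "v ((i + 1) mod 3 + 1)"
  have "linear (\<lambda>x. cross2 (?b - ?a) x / tri_det v)"
    by (rule linearI) (auto simp: cross2_def algebra_simps diff_divide_distrib add_divide_distrib)
  moreover have "bary v i = (\<lambda>x. - cross2 (?b - ?a) ?a / tri_det v + cross2 (?b - ?a) x / tri_det v)"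
    by (rule ext) (simp add: bary_def cross2_def algebra_simps diff_divide_distrib add_divide_distrib)
  ultimately show ?thesis by blast
qed

lemma bary_sum:
  assumes "tri_det v \<noteq> 0"
  shows "bary v 1 x + bary v 2 x + bary v 3 x = 1"
proof -
  have "bary v 1 x + bary v 2 x + bary v 3 x = tri_det v / tri_det v"
    unfolding bary_def add_divide_distrib[symmetric]
    by (rule arg_cong[where f = "\<lambda>t. t / tri_det v"])
      (simp add: tri_det_def cross2_def algebra_simps del: One_nat_def)
  then show ?thesis using assms by simp
qed

lemma bary_combination:
  assumes "tri_det v \<noteq> 0"
  shows "x = bary v 1 x *\<^sub>R v 1 + bary v 2 x *\<^sub>R v 2 + bary v 3 x *\<^sub>R v 3"
proof -
  have "x $ k = (cross2 (v 3 - v 2) (x - v 2) * v 1 $ k + cross2 (v 1 - v 3) (x - v 3) * v 2 $ k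
      + cross2 (v 2 - v 1) (x - v 1) * v 3 $ k) / tri_det v" for k
  proof -
    have "k = 1 \<or> k = 2" by (metis exhaust_2)
    then have "x $ k * tri_det v = cross2 (v 3 - v 2) (x - v 2) * v 1 $ k
        + cross2 (v 1 - v 3) (x - v 3) * v 2 $ k + cross2 (v 2 - v 1) (x - v 1) * v 3 $ k"
      by (auto simp: tri_det_def cross2_def algebra_simps simp del: One_nat_def)
    then show ?thesis using assms by (simp add: eq_divide_eq)
  qed
  then show ?thesis
    by (simp add: vec_eq_iff bary_def add_divide_distrib del: One_nat_def)
qed

lemma affine_bary:
  assumes "linear h" "tri_det v \<noteq> 0"
  shows "c + h x = bary v 1 x *\<^sub>R (c + h (v 1)) + bary v 2 x *\<^sub>R (c + h (v 2))
    + bary v 3 x *\<^sub>R (c + h (v 3))"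
proof -
  have "h x = bary v 1 x *\<^sub>R h (v 1) + bary v 2 x *\<^sub>R h (v 2) + bary v 3 x *\<^sub>R h (v 3)"
    by (subst bary_combination[OF assms(2), of x])
      (simp add: linear_add[OF assms(1)] linear_scale[OF assms(1)])
  moreover have "c = (bary v 1 x + bary v 2 x + bary v 3 x) *\<^sub>R c"
    using bary_sum[OF assms(2)] by simp
  ultimately show ?thesis
    by (simp add: algebra_simps)
qed

lemma bary_nonneg_tri:
  assumes "tri_det v \<noteq> 0" "x \<in> tri v" "i \<in> {1..3}"
  shows "0 \<le> bary v i x"
proof -
  obtain c h where h: "linear h" and b: "bary v i = (\<lambda>x. c + h x)" using bary_affine by blast
  have "convex {x. 0 \<le> bary v i x}"
  proof -
    have "{x. 0 \<le> bary v i x} = h -` {-c..}" by (auto simp: b)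
    then show ?thesis using h by (simp add: convex_linear_vimage)
  qed
  moreover have "v ` {1..3} \<subseteq> {x. 0 \<le> bary v i x}"
    using assms bary_vertex[OF assms(1,3)] by auto
  ultimately have "tri v \<subseteq> {x. 0 \<le> bary v i x}"
    unfolding tri_def by (rule hull_minimal[rotated])
  then show ?thesis using assms by blast
qed

section \<open>The centroid\<close>

lemma tri_compact: "compact (tri v)"
  unfolding tri_def by (simp add: finite_imp_compact_convex_hull)

lemma tri_lmeasurable: "tri v \<in> lmeasurable"
  by (simp add: tri_compact lmeasurable_compact)

lemma area_tri_pos:
  assumes "tri_det v \<noteq> 0"
  shows "0 < area (tri v)"
proof -
  \<comment> \<open>A convex set without interior lies on a line, but the edge vectors at \<open>v 1\<close> are independent.\<close>
  have "interior (tri v) \<noteq> {}"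
  proof
    assume "interior (tri v) = {}"
    moreover have "convex (tri v)" by (simp add: tri_def)
    ultimately obtain a b where ab: "a \<noteq> 0" "tri v \<subseteq> {x. a \<bullet> x = b}"
      using empty_interior_subset_hyperplane by blast
    have "v j \<in> tri v" if "j \<in> {1..3}" for j
      unfolding tri_def using that by (simp add: hull_inc)
    then have "v 1 \<in> tri v" "v 2 \<in> tri v" "v 3 \<in> tri v" by auto
    then have "a \<bullet> v 1 = b" "a \<bullet> v 2 = b" "a \<bullet> v 3 = b"
      using ab(2) by (auto simp: subset_eq)
    then have z: "a \<bullet> (v 2 - v 1) = 0" "a \<bullet> (v 3 - v 1) = 0" by (simp_all add: inner_diff_right)
    have "a $ 1 * tri_det v
        = (v 3 - v 1) $ 2 * (a \<bullet> (v 2 - v 1)) - (v 2 - v 1) $ 2 * (a \<bullet> (v 3 - v 1))"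
      "a $ 2 * tri_det v
        = (v 2 - v 1) $ 1 * (a \<bullet> (v 3 - v 1)) - (v 3 - v 1) $ 1 * (a \<bullet> (v 2 - v 1))"
      by (simp_all add: tri_det_def cross2_def inner_vec_def sum_2 algebra_simps)
    then have "a = 0" using assms z by (simp add: vec_eq_iff forall_2)
    then show False using ab by simp
  qed
  then have "\<not> negligible (tri v)"
    by (subst negligible_convex_interior) (simp_all add: tri_def)
  then show ?thesis
    using negligible_iff_measure0[OF tri_lmeasurable, of v] measure_nonneg[of lebesgue "tri v"]
    by linarith
qed

lemma identity_absolutely_integrable_tri: "(\<lambda>x. x) absolutely_integrable_on tri v"
proof -
  obtain a b where ab: "tri v \<subseteq> cbox a b"
    using bounded_subset_cbox_symmetric[OF compact_imp_bounded[OF tri_compact]] by metis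
  have "(\<lambda>x. x) absolutely_integrable_on cbox a b"
    by (intro absolutely_integrable_continuous continuous_intros)
  then show ?thesis
    using fmeasurableD[OF tri_lmeasurable] ab by (rule set_integrable_subset)
qed

lemma integral_affine:
  fixes h :: "real^2 \<Rightarrow> 'u::euclidean_space"
  assumes "linear h" "0 < area (tri v)"
  shows "integral (tri v) (\<lambda>x. c + h x) = area (tri v) *\<^sub>R (c + h (cell_average (tri v) (\<lambda>x. x)))"
proof -
  let ?K = "tri v"
  have bl: "bounded_linear h" using assms(1) by (simp add: linear_conv_bounded_linear)
  have idi: "(\<lambda>x::real^2. x) integrable_on ?K"
    using identity_absolutely_integrable_tri
    by (rule set_lebesgue_integral_eq_integral)
  have hi: "integral ?K h = h (integral ?K (\<lambda>x. x))"
    using integral_linear[OF idi bl] by (simp add: o_def)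
  have c: "integral ?K (\<lambda>x. c) = area ?K *\<^sub>R c"
  proof -
    have "integral ?K (\<lambda>x. (1::real) *\<^sub>R c) = integral ?K (\<lambda>x. 1::real) *\<^sub>R c"
      using integral_linear[OF integrable_on_const[OF tri_lmeasurable, of 1] bounded_linear_scaleR_left]
      by (simp add: o_def)
    then show ?thesis using lmeasure_integral[OF tri_lmeasurable, of v] by simp
  qed
  have "integral ?K (\<lambda>x. c + h x) = integral ?K (\<lambda>x. c) + integral ?K h"
    using integrable_linear[OF idi bl] integrable_on_const[OF tri_lmeasurable]
    by (intro Henstock_Kurzweil_Integration.integral_add) (auto simp: o_def)
  then show ?thesis using assms
    by (simp add: hi c cell_average_def scaleR_add_right linear_scale[OF assms(1)])
qed

lemma convex_hull_affine_image:
  assumes "linear h"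
  shows "(\<lambda>x. c + h x) ` (convex hull S) = convex hull ((\<lambda>x. c + h x) ` S)"
proof -
  have "convex hull ((\<lambda>x. c + x) ` (h ` S)) = (\<lambda>x. c + x) ` (h ` (convex hull S))"
    by (simp only: convex_hull_translation convex_hull_linear_image[OF assms])
  then show ?thesis by (simp add: image_image)
qed

text \<open>
  Comparing the volume of \<open>tri v\<close> with that of its image shows that the affine map has
  determinant \<open>1\<close> up to sign, so the change of variables leaves the first moment unchanged.
\<close>

lemma cell_average_identity_fixed:
  fixes h :: "real^2 \<Rightarrow> real^2"
  assumes "linear h" and inj: "inj_on (\<lambda>x. c + h x) (tri v)"
    and onto: "(\<lambda>x. c + h x) ` tri v = tri v" and pos: "0 < area (tri v)"
  shows "c + h (cell_average (tri v) (\<lambda>x. x)) = cell_average (tri v) (\<lambda>x. x)"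
proof -
  let ?K = "tri v" and ?g = "\<lambda>x. c + h x"
  let ?d = "\<bar>det (matrix h)\<bar>"
  have "measure lebesgue ((\<lambda>x. c + x) ` (h ` ?K)) = ?d * area ?K"
    using measure_linear_image[OF assms(1) tri_lmeasurable] by (simp only: measure_translation)
  then have "area ?K = ?d * area ?K" using onto by (simp add: image_image)
  then have d: "?d = 1" using pos by simp
  have S: "?K \<in> sets lebesgue" using tri_lmeasurable by (rule fmeasurableD)
  have bl: "bounded_linear h" using assms(1) by (simp add: linear_conv_bounded_linear)
  have der: "(?g has_derivative h) (at x within ?K)" for x
    using bounded_linear_imp_has_derivative[OF bl] by (auto intro!: derivative_eq_intros)
  have "integral ?K (\<lambda>x. ?d *\<^sub>R ?g x) = integral (?g ` ?K) (\<lambda>x. x)"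
    using integral_change_of_variables[OF S der inj, of "\<lambda>x. x"]
      identity_absolutely_integrable_tri[of v] unfolding onto by auto
  then have "integral ?K ?g = integral ?K (\<lambda>x. x)" unfolding d onto by simp
  then have "area ?K *\<^sub>R (c + h (cell_average ?K (\<lambda>x. x))) = integral ?K (\<lambda>x. x)"
    using integral_affine[OF assms(1) pos, of c] by simp
  also have "\<dots> = area ?K *\<^sub>R cell_average ?K (\<lambda>x. x)"
    using pos by (simp add: cell_average_def)
  finally show ?thesis using pos by simp
qed

text \<open>
  Exchanging two vertices is an affine symmetry of the triangle that exchanges the corresponding
  barycentric coordinates, and the centre of mass is fixed by it.
\<close>

lemma bary_centre_eq:
  assumes D: "tri_det v \<noteq> 0" and i: "i \<in> {1..3}" and j: "j \<in> {1..3}"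
  shows "bary v i (cell_average (tri v) (\<lambda>x. x)) = bary v j (cell_average (tri v) (\<lambda>x. x))"
proof (cases "i = j")
  case False
  obtain ci hi cj hj where h: "linear hi" "linear hj"
    and b: "bary v i = (\<lambda>x. ci + hi x)" "bary v j = (\<lambda>x. cj + hj x)"
    using bary_affine by metis
  \<comment> \<open>The affine map that exchanges \<open>v i\<close> and \<open>v j\<close> and fixes the third vertex.\<close>
  define g where "g x = x + (bary v i x - bary v j x) *\<^sub>R (v j - v i)" for x
  define c k where "c = (ci - cj) *\<^sub>R (v j - v i)"
    and "k x = x + (hi x - hj x) *\<^sub>R (v j - v i)" for x
  have k: "linear k"
    using h by (auto intro!: linearI simp: k_def linear_add linear_scale algebra_simps)
  have g: "g = (\<lambda>x. c + k x)"
    by (rule ext) (simp add: g_def b c_def k_def algebra_simps)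
  have vert: "g (v m) = (if m = i then v j else if m = j then v i else v m)" if "m \<in> {1..3}" for m
    using False i j that by (simp add: g_def bary_vertex[OF D])
  have "g ` v ` {1..3} = v ` {1..3}"
  proof -
    have "(\<lambda>m. if m = i then j else if m = j then i else m) ` {1..3} = {1..3}"
      using i j by (force simp: image_iff)
    moreover have "g ` v ` {1..3} = v ` (\<lambda>m. if m = i then j else if m = j then i else m) ` {1..3}"
      unfolding image_image by (rule image_cong) (simp_all add: vert)
    ultimately show ?thesis by simp
  qed
  then have onto: "(\<lambda>x. c + k x) ` tri v = tri v"
    unfolding tri_def convex_hull_affine_image[OF k] g by simp
  have swap: "bary v i (g x) = bary v j x" "bary v j (g x) = bary v i x" for x
  proof -
    have lin: "hi (v j - v i) = -1" "hj (v j - v i) = 1"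
      using False bary_vertex[OF D i i] bary_vertex[OF D i j] bary_vertex[OF D j j]
        bary_vertex[OF D j i] by (simp_all add: b linear_diff[OF h(1)] linear_diff[OF h(2)])
    show "bary v i (g x) = bary v j x" "bary v j (g x) = bary v i x"
      unfolding b g_def linear_add[OF h(1)] linear_add[OF h(2)] linear_scale[OF h(1)]
        linear_scale[OF h(2)] lin by simp_all
  qed
  have "g (g x) = x" for x
    unfolding g_def[of "g x"] swap by (simp add: g_def algebra_simps)
  then have "inj g" by (metis injI)
  then have "inj_on (\<lambda>x. c + k x) (tri v)" unfolding g by (rule inj_on_subset) simp
  from cell_average_identity_fixed[OF k this onto area_tri_pos[OF D]]
  have "g (cell_average (tri v) (\<lambda>x. x)) = cell_average (tri v) (\<lambda>x. x)" unfolding g .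
  then show ?thesis using swap(1) by metis
qed simp

text \<open>
  All barycentric coordinates of the centre of mass agree, so it is the centroid, at which an affine
  function takes the mean of its vertex values.
\<close>

lemma cell_average_affine:
  fixes h :: "real^2 \<Rightarrow> 'u::euclidean_space"
  assumes D: "tri_det v \<noteq> 0" and h: "linear h"
  shows "cell_average (tri v) (\<lambda>x. c + h x)
    = (1/3) *\<^sub>R ((c + h (v 1)) + (c + h (v 2)) + (c + h (v 3)))"
proof -
  let ?m = "cell_average (tri v) (\<lambda>x. x)"
  have "bary v 1 ?m = bary v 2 ?m" "bary v 1 ?m = bary v 3 ?m"
    by (rule bary_centre_eq[OF D]; simp)+
  with bary_sum[OF D, of ?m]
  have "bary v 1 ?m = 1/3" "bary v 2 ?m = 1/3" "bary v 3 ?m = 1/3" by linarith+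
  then have "c + h ?m = (1/3) *\<^sub>R ((c + h (v 1)) + (c + h (v 2)) + (c + h (v 3)))"
    by (subst affine_bary[OF h D, of c ?m]) (simp only: scaleR_add_right)
  moreover have "cell_average (tri v) (\<lambda>x. c + h x) = c + h ?m"
    using integral_affine[OF h area_tri_pos[OF D], of c] area_tri_pos[OF D]
    by (simp add: cell_average_def)
  ultimately show ?thesis by simp
qed

section \<open>Edges and outward normals\<close>

lemma edge_length_pos:
  assumes "tri_det v \<noteq> 0" "i \<in> {1..3}"
  shows "0 < edge_length v i"
  using assms tri_det_edge[OF assms(2), of v] by (auto simp: edge_length_def cross2_def)

text \<open>Clockwise rotation by a right angle.\<close>

definition rot :: "real^2 \<Rightarrow> real^2" where
  "rot x = vector [x $ 2, - (x $ 1)]"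

lemma rot_nth [simp]: "rot x $ 1 = x $ 2" "rot x $ 2 = - (x $ 1)"
  by (simp_all add: rot_def)

lemma inner_rot: "rot x \<bullet> y = - cross2 x y"
  by (simp add: inner_vec_def sum_2 cross2_def)

lemma norm_rot: "norm (rot x) = norm x"
  by (simp add: norm_eq_sqrt_inner inner_vec_def sum_2 add.commute)

lemma vertices_edge:
  assumes "i \<in> {1..3::nat}"
  shows "v ` {1..3} = {v i, v (i mod 3 + 1), v ((i + 1) mod 3 + 1)}"
  using assms unfolding one_to_three by (elim insertE emptyE) (auto simp del: One_nat_def)

lemma edge_vertices_in_tri:
  assumes "i \<in> {1..3}"
  shows "v i \<in> tri v" "v (i mod 3 + 1) \<in> tri v" "v ((i + 1) mod 3 + 1) \<in> tri v"
  unfolding tri_def vertices_edge[OF assms] by (simp_all add: hull_inc)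

lemma edge_vertices_in_edge: "v (i mod 3 + 1) \<in> edge v i" "v ((i + 1) mod 3 + 1) \<in> edge v i"
  by (simp_all add: edge_def)

lemma unit_normal_cases:
  fixes n p :: "real^2"
  assumes "norm n = 1" "n \<bullet> p = 0"
  obtains m where "m = norm p \<or> m = - norm p" "(norm p)\<^sup>2 *\<^sub>R n = m *\<^sub>R rot p"
proof -
  have "(n \<bullet> rot p)\<^sup>2 + (n \<bullet> p)\<^sup>2 = (norm n)\<^sup>2 * (norm p)\<^sup>2"
    unfolding power2_norm_eq_inner
    by (simp add: inner_vec_def sum_2 power2_eq_square algebra_simps)
  then have "(n \<bullet> rot p)\<^sup>2 = (norm p)\<^sup>2" using assms by simp
  then have m: "n \<bullet> rot p = norm p \<or> n \<bullet> rot p = - norm p" by (simp add: power2_eq_iff)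
  have "(norm p)\<^sup>2 *\<^sub>R n = (n \<bullet> rot p) *\<^sub>R rot p + (n \<bullet> p) *\<^sub>R p"
    unfolding power2_norm_eq_inner
    by (simp add: vec_eq_iff forall_2 inner_vec_def sum_2 algebra_simps)
  then show thesis using that[OF m] assms by simp
qed

text \<open>
  Only two unit vectors are orthogonal to the edge. The one pointing outward is singled out by the
  side on which the opposite vertex lies, that is, by the orientation of the labelling.
\<close>

lemma outward_normal_eq:
  assumes D: "tri_det v \<noteq> 0" and i: "i \<in> {1..3}"
  shows "outward_normal v i = (sgn (tri_det v) / edge_length v i) *\<^sub>R
    rot (v ((i + 1) mod 3 + 1) - v (i mod 3 + 1))"
proof -
  define a b where "a = v (i mod 3 + 1)" and "b = v ((i + 1) mod 3 + 1)"
  define l where "l = edge_length v i"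
  have l: "l > 0" "norm (b - a) = l"
    using edge_length_pos[OF D i] by (simp_all add: l_def edge_length_def a_def b_def dist_norm norm_minus_commute)
  have det: "rot (b - a) \<bullet> (v i - a) = - tri_det v"
    using tri_det_edge[OF i, of v] by (simp add: inner_rot a_def b_def)
  let ?n = "(sgn (tri_det v) / l) *\<^sub>R rot (b - a)"
  let ?P = "\<lambda>n. norm n = 1 \<and> (\<forall>x\<in>edge v i. \<forall>y\<in>edge v i. n \<bullet> (x - y) = 0) \<and>
     (\<forall>x\<in>tri v. \<forall>y\<in>edge v i. n \<bullet> (x - y) \<le> 0)"
  have "?P ?n"
  proof (intro conjI ballI)
    show "norm ?n = 1" using D l by (simp add: norm_rot abs_sgn_eq)
    have z: "?n \<bullet> (b - a) = 0" by (simp add: inner_rot cross2_def)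
    have e: "?n \<bullet> y = ?n \<bullet> a" if y: "y \<in> edge v i" for y
    proof -
      obtain t where "y = (1 - t) *\<^sub>R a + t *\<^sub>R b"
        using y by (auto simp: edge_def closed_segment_def a_def b_def)
      then have "y = a + t *\<^sub>R (b - a)" by (simp add: algebra_simps)
      then have "?n \<bullet> y = ?n \<bullet> a + t * (?n \<bullet> (b - a))" by (metis inner_add_right inner_scaleR_right)
      then show ?thesis using z by simp
    qed
    show "?n \<bullet> (x - y) = 0" if "x \<in> edge v i" "y \<in> edge v i" for x y
      by (simp only: inner_diff_right e[OF that(1)] e[OF that(2)] diff_self)
    have "?n \<bullet> (v i - a) = - \<bar>tri_det v\<bar> / l"
      using det by (simp add: abs_sgn mult.commute)
    then have "?n \<bullet> (v i - a) \<le> 0" using l by simp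
    then have "v ` {1..3} \<subseteq> {x. ?n \<bullet> x \<le> ?n \<bullet> a}"
      unfolding vertices_edge[OF i] insert_subset mem_Collect_eq inner_diff_right diff_le_0_iff_le
        e[OF edge_vertices_in_edge(1)] e[OF edge_vertices_in_edge(2)] by blast
    then have "tri v \<subseteq> {x. ?n \<bullet> x \<le> ?n \<bullet> a}"
      unfolding tri_def by (rule hull_minimal) (rule convex_halfspace_le)
    then show "?n \<bullet> (x - y) \<le> 0" if "x \<in> tri v" "y \<in> edge v i" for x y
      unfolding inner_diff_right using e[OF that(2)] that(1) by auto
  qed
  moreover have "n = ?n" if P: "?P n" for n
  proof -
    have "n \<bullet> (b - a) = 0" "n \<bullet> (v i - a) \<le> 0"
      using P edge_vertices_in_edge[of v i] edge_vertices_in_tri(1)[OF i, of v]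
      unfolding a_def b_def by blast+
    with P obtain m where m: "m = l \<or> m = - l" "l\<^sup>2 *\<^sub>R n = m *\<^sub>R rot (b - a)"
      using unit_normal_cases[of n "b - a"] l(2) by metis
    have "m * - tri_det v = l\<^sup>2 * (n \<bullet> (v i - a))"
      using arg_cong[OF m(2), of "\<lambda>x. x \<bullet> (v i - a)"] det by simp
    then have "m * tri_det v \<ge> 0"
      using \<open>n \<bullet> (v i - a) \<le> 0\<close> mult_nonneg_nonpos[of "l\<^sup>2"] by fastforce
    then have "m = sgn (tri_det v) * l"
      using m(1) l(1) D by (auto simp: sgn_if zero_le_mult_iff mult_le_0_iff)
    then have "l\<^sup>2 *\<^sub>R n = l\<^sup>2 *\<^sub>R ?n"
      unfolding m(2) using l(1) by (simp add: power2_eq_square mult.commute)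
    then show ?thesis unfolding scaleR_cancel_left using l(1) by simp
  qed
  ultimately have "(THE n. ?P n) = ?n" by (rule the_equality)
  then show ?thesis unfolding outward_normal_def l_def a_def b_def .
qed

lemma norm_outward_normal:
  assumes "tri_det v \<noteq> 0" "i \<in> {1..3}"
  shows "norm (outward_normal v i) = 1"
  using edge_length_pos[OF assms] assms(1)
  by (simp add: outward_normal_eq[OF assms] norm_rot abs_sgn_eq edge_length_def dist_norm norm_minus_commute)

text \<open>
  Up to a common sign, the scaled normals are the rotated edge vectors, and these form a closed
  polygon.
\<close>

lemma sum_scaled_normals:
  assumes D: "tri_det v \<noteq> 0"
  shows "(\<Sum>i=1..3. edge_length v i *\<^sub>R outward_normal v i) = 0"
proof -
  have "edge_length v i *\<^sub>R outward_normal v i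
      = sgn (tri_det v) *\<^sub>R rot (v ((i + 1) mod 3 + 1) - v (i mod 3 + 1))" if "i \<in> {1..3}" for i
    using edge_length_pos[OF D that] by (simp add: outward_normal_eq[OF D that])
  then have "(\<Sum>i=1..3. edge_length v i *\<^sub>R outward_normal v i)
      = (\<Sum>i=1..3. sgn (tri_det v) *\<^sub>R rot (v ((i + 1) mod 3 + 1) - v (i mod 3 + 1)))"
    by (rule sum.cong[OF refl])
  also have "\<dots> = 0"
    unfolding sum_three by (simp add: vec_eq_iff forall_2 algebra_simps del: One_nat_def)
  finally show ?thesis .
qed

section \<open>Quadrature on the edges\<close>

lemma edge_path_in_edge: "t \<in> {0..1} \<Longrightarrow> edge_path v i t \<in> edge v i"
  unfolding edge_path_def edge_def by (metis imageI linepath_image_01)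

lemma affine_edge_path:
  assumes "linear h"
  shows "c + h (edge_path v i t)
    = (1 - t) *\<^sub>R (c + h (v (i mod 3 + 1))) + t *\<^sub>R (c + h (v ((i + 1) mod 3 + 1)))"
  unfolding edge_path_def linepath_def linear_add[OF assms] linear_scale[OF assms]
  by (simp add: algebra_simps)

lemma integral_square_shift: "((\<lambda>t::real. (t - s)\<^sup>2) has_integral ((1 - s)^3 + s^3) / 3) {0..1}"
proof -
  have "((\<lambda>t::real. (t - s)\<^sup>2) has_integral ((1 - s)^3 / 3 - (0 - s)^3 / 3)) {0..1}"
    by (rule fundamental_theorem_of_calculus)
      (auto intro!: derivative_eq_intros simp flip: has_real_derivative_iff_has_vector_derivative)
  then show ?thesis by (simp add: add_divide_distrib)
qed

lemma
  assumes "gauss_rule 2 \<tau> \<omega>"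
  shows gauss_2_sum: "(\<Sum>\<nu>=1..2. \<omega> \<nu>) = 1"
    and gauss_2_mean: "(\<Sum>\<nu>=1..2. \<omega> \<nu> * \<tau> \<nu>) = 1/2"
    and gauss_2_pos: "\<nu> \<in> {1..2} \<Longrightarrow> 0 < \<omega> \<nu>"
    and gauss_2_node: "\<nu> \<in> {1..2} \<Longrightarrow> \<tau> \<nu> \<in> {0..1}"
proof -
  have ex: "(\<Sum>\<nu>=1..2. \<omega> \<nu> * poly p (\<tau> \<nu>)) = integral {0..1} (poly p)" if "degree p < 4" for p
    using assms that by (simp add: gauss_rule_def)
  have "poly [:1:] = (\<lambda>t::real. 1)" "poly [:0, 1:] = (\<lambda>t::real. t)" by auto
  then show "(\<Sum>\<nu>=1..2. \<omega> \<nu>) = 1" "(\<Sum>\<nu>=1..2. \<omega> \<nu> * \<tau> \<nu>) = 1/2"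
    using ex[of "[:1:]"] ex[of "[:0, 1:]"] ident_has_integral[of 0 "1::real"]
    by (simp_all add: integral_unique)
  show "\<nu> \<in> {1..2} \<Longrightarrow> \<tau> \<nu> \<in> {0..1}" using assms unfolding gauss_rule_def by blast
  \<comment> \<open>Placing \<open>s\<close> at one of the nodes leaves a single term, whose weight must then be positive.\<close>
  have sq: "\<omega> 1 * (\<tau> 1 - s)\<^sup>2 + \<omega> 2 * (\<tau> 2 - s)\<^sup>2 = ((1 - s)^3 + s^3) / 3" for s
  proof -
    have "poly [:s\<^sup>2, - 2 * s, 1:] = (\<lambda>t. (t - s)\<^sup>2)"
      by (rule ext) (simp add: power2_eq_square algebra_simps)
    then show ?thesis
      using ex[of "[:s\<^sup>2, - 2 * s, 1:]"] integral_unique[OF integral_square_shift[of s]]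
      by (simp add: sum_two del: One_nat_def)
  qed
  have pos: "((1 - s)^3 + s^3) / 3 > 0" for s :: real
  proof -
    have "((1 - s)^3 + s^3) / 3 = (s - 1/2)\<^sup>2 + 1/12"
      by (simp add: power3_eq_cube power2_eq_square field_simps)
    then show ?thesis using zero_le_power2[of "s - 1/2"] by linarith
  qed
  have "\<omega> 1 * (\<tau> 1 - \<tau> 2)\<^sup>2 > 0" "\<omega> 2 * (\<tau> 2 - \<tau> 1)\<^sup>2 > 0"
    using sq[of "\<tau> 2"] sq[of "\<tau> 1"] pos[of "\<tau> 2"] pos[of "\<tau> 1"] by simp_all
  then have "\<omega> 1 > 0" "\<omega> 2 > 0" by (auto simp: zero_less_mult_iff)
  moreover assume "\<nu> \<in> {1..2}"
  then have "\<nu> = 1 \<or> \<nu> = 2" by auto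
  ultimately show "\<omega> \<nu> > 0" by auto
qed

lemma gauss_2_affine:
  assumes "gauss_rule 2 \<tau> \<omega>" "linear h"
  shows "(\<Sum>\<nu>=1..2. \<omega> \<nu> *\<^sub>R (c + h (edge_path v i (\<tau> \<nu>))))
    = (1/2) *\<^sub>R ((c + h (v (i mod 3 + 1))) + (c + h (v ((i + 1) mod 3 + 1))))"
proof -
  let ?a = "c + h (v (i mod 3 + 1))" and ?b = "c + h (v ((i + 1) mod 3 + 1))"
  have "(\<Sum>\<nu>=1..2. \<omega> \<nu> *\<^sub>R (c + h (edge_path v i (\<tau> \<nu>))))
      = (\<Sum>\<nu>=1..2. (\<omega> \<nu> - \<omega> \<nu> * \<tau> \<nu>) *\<^sub>R ?a + (\<omega> \<nu> * \<tau> \<nu>) *\<^sub>R ?b)"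
    unfolding affine_edge_path[OF assms(2)]
    by (intro sum.cong refl) (simp add: algebra_simps)
  also have "\<dots> = ((\<Sum>\<nu>=1..2. \<omega> \<nu>) - (\<Sum>\<nu>=1..2. \<omega> \<nu> * \<tau> \<nu>)) *\<^sub>R ?a
      + (\<Sum>\<nu>=1..2. \<omega> \<nu> * \<tau> \<nu>) *\<^sub>R ?b"
    unfolding sum.distrib sum_subtractf[symmetric] scaleR_sum_left ..
  finally show ?thesis
    unfolding gauss_2_sum[OF assms(1)] gauss_2_mean[OF assms(1)]
    by (simp add: scaleR_add_right)
qed

lemma edge_integral_affine:
  assumes "linear h"
  shows "edge_integral v i (\<lambda>x. c + h x)
    = edge_length v i * (((c + h (v (i mod 3 + 1))) + (c + h (v ((i + 1) mod 3 + 1)))) / 2)"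
proof -
  let ?a = "c + h (v (i mod 3 + 1))" and ?b = "c + h (v ((i + 1) mod 3 + 1))"
  have "((\<lambda>t. ?a + t * (?b - ?a)) has_integral (?a + (1/2) * (?b - ?a))) {0..1::real}"
    using has_integral_add[OF has_integral_const_real[of ?a 0 1]
        has_integral_mult_left[OF ident_has_integral[of 0 1], of "?b - ?a"]] by simp
  then have "integral {0..1} (\<lambda>t. ?a + t * (?b - ?a)) = (?a + ?b) / 2"
    by (simp only: integral_unique) (simp add: field_simps)
  moreover have "(\<lambda>t. c + h (edge_path v i t)) = (\<lambda>t. ?a + t * (?b - ?a))"
    by (rule ext) (simp add: affine_edge_path[OF assms, of c] algebra_simps)
  ultimately show ?thesis unfolding edge_integral_def by simp
qed

section \<open>The optimal decomposition\<close>

lemma sum_edge_weight: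
  "(\<Sum>i=1..3. edge_weight v i) = cfl_const v * (\<Sum>i=1..3. edge_length v i)"
  by (simp add: edge_weight_def cfl_const_def sum_distrib_left)

text \<open>
  The sum is \<open>2/3 (1 + l\<^sub>3 / (l\<^sub>1 + l\<^sub>2))\<close>, and the last quotient is at most \<open>1/2\<close>, with equality only if
  all lengths coincide.
\<close>

lemma
  assumes "0 < edge_length v 3" "edge_length v 3 \<le> edge_length v 2"
    "edge_length v 2 \<le> edge_length v 1"
  shows sum_edge_weight_le_1: "(\<Sum>i=1..3. edge_weight v i) \<le> 1"
    and edge_weight_if_sum_eq_1: "(\<Sum>i=1..3. edge_weight v i) = 1 \<Longrightarrow> i \<in> {1..3} \<Longrightarrow> edge_weight v i = 1/3"
proof -
  have W: "(\<Sum>i=1..3. edge_weight v i)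
      = 2 * (edge_length v 1 + edge_length v 2 + edge_length v 3)
        / (3 * (edge_length v 1 + edge_length v 2))"
    unfolding sum_edge_weight by (simp only: sum_three) (simp add: cfl_const_def)
  have pos: "0 < 3 * (edge_length v 1 + edge_length v 2)" using assms by simp
  show "(\<Sum>i=1..3. edge_weight v i) \<le> 1"
    unfolding W using assms pos by (simp add: pos_divide_le_eq)
  assume "(\<Sum>i=1..3. edge_weight v i) = 1" and i: "i \<in> {1..3}"
  then have "2 * (edge_length v 1 + edge_length v 2 + edge_length v 3)
      = 3 * (edge_length v 1 + edge_length v 2)"
    unfolding W using pos by (simp add: divide_eq_eq)
  moreover have "a = c \<and> b = c" if "2 * (a + b + c) = 3 * (a + b)" "c \<le> b" "b \<le> a" for a b c :: real
  proof -
    have "2 * c = a + b" using that(1) by (simp add: algebra_simps)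
    then have "a \<le> c" "b \<le> c" using that(2,3) by linarith+
    then show ?thesis using that(2,3) by simp
  qed
  ultimately have "edge_length v 1 = edge_length v 3" "edge_length v 2 = edge_length v 3"
    using assms(2,3) by blast+
  moreover have "i = 1 \<or> i = 2 \<or> i = 3" using i by auto
  ultimately show "edge_weight v i = 1/3"
    using assms(1) by (auto simp: edge_weight_def)
qed

text \<open>
  Each edge contributes a third of its midpoint value, so every vertex value occurs with weight \<open>1/3\<close>
  in the sum.
\<close>

lemma cell_average_edge_means:
  fixes p :: "real^2 \<Rightarrow> 'u::euclidean_space"
  assumes D: "tri_det v \<noteq> 0" and gauss: "gauss_rule 2 \<tau> \<omega>" and p: "p \<in> polys 1"
  shows "cell_average (tri v) p
    = (\<Sum>i=1..3. (1/3) *\<^sub>R (\<Sum>\<nu>=1..2. \<omega> \<nu> *\<^sub>R p (edge_path v i (\<tau> \<nu>))))"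
proof -
  obtain c h where h: "linear h" and p: "p = (\<lambda>z. c + h z)" using p polys_1_iff_affine by blast
  show ?thesis
    unfolding p cell_average_affine[OF D h] gauss_2_affine[OF gauss h] sum_three
    by (simp add: scaleR_add_right algebra_simps del: One_nat_def flip: scaleR_left_distrib)
qed

text \<open>
  For \<open>W \<noteq> 1\<close> the \<open>star_value\<close> is defined so as to make this true. For \<open>W = 1\<close> it is multiplied by
  zero, and the edge weights are all \<open>1/3\<close>.
\<close>

lemma cell_average_splitting:
  fixes u :: "(real^2) set \<Rightarrow> real^2 \<Rightarrow> 'u::euclidean_space"
  assumes K: "K = tri (vtx K)" and D: "tri_det (vtx K) \<noteq> 0"
    and sorted: "edge_length (vtx K) 3 \<le> edge_length (vtx K) 2"
      "edge_length (vtx K) 2 \<le> edge_length (vtx K) 1"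
    and gauss: "gauss_rule 2 \<tau> \<omega>" and p: "u K \<in> polys 1"
  shows "cell_average K (u K)
    = (1 - (\<Sum>i=1..3. edge_weight (vtx K) i)) *\<^sub>R star_value vtx 2 \<tau> \<omega> u K
      + (\<Sum>i=1..3. edge_weight (vtx K) i *\<^sub>R
          (\<Sum>\<nu>=1..2. \<omega> \<nu> *\<^sub>R int_trace u K (edge_path (vtx K) i (\<tau> \<nu>))))"
proof (cases "(\<Sum>i=1..3. edge_weight (vtx K) i) = 1")
  case False
  then show ?thesis by (simp add: star_value_def)
next
  case True
  have l3: "0 < edge_length (vtx K) 3" by (rule edge_length_pos[OF D]) simp
  have "edge_weight (vtx K) i = 1/3" if "i \<in> {1..3}" for i
    by (rule edge_weight_if_sum_eq_1[OF l3 sorted True that])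
  then have "(\<Sum>i=1..3. edge_weight (vtx K) i *\<^sub>R
        (\<Sum>\<nu>=1..2. \<omega> \<nu> *\<^sub>R int_trace u K (edge_path (vtx K) i (\<tau> \<nu>))))
      = (\<Sum>i=1..3. (1/3) *\<^sub>R (\<Sum>\<nu>=1..2. \<omega> \<nu> *\<^sub>R u K (edge_path (vtx K) i (\<tau> \<nu>))))"
    by (intro sum.cong) (simp_all add: int_trace_def)
  also have "\<dots> = cell_average (tri (vtx K)) (u K)"
    by (rule cell_average_edge_means[OF D gauss p, symmetric])
  finally show ?thesis using True K by simp
qed

text \<open>
  The test function is the barycentric coordinate of \<open>v 3\<close>. Its mean is \<open>1/3\<close> on the triangle, \<open>1/2\<close> on
  each of the edges \<open>1\<close> and \<open>2\<close>, and \<open>0\<close> on the edge \<open>3\<close>, and it is nonnegative at the nodes \<open>\<xi> s\<close>.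
  Hence \<open>w\<^sub>1 + w\<^sub>2 \<le> 2/3\<close>, while the sum is at least \<open>l\<^sub>1 + l\<^sub>2\<close> times the minimum in question.
\<close>

lemma feasible_decomposition_bound:
  assumes D: "tri_det v \<noteq> 0" and feas: "feasible_decomposition 1 v w S \<omega> \<xi>"
  shows "Min ((\<lambda>i. w i / edge_length v i) ` {1..3}) \<le> cfl_const v"
proof -
  obtain c h where h: "linear h" and b: "bary v 3 = (\<lambda>x. c + h x)" using bary_affine by blast
  have vert: "c + h (v 1) = 0" "c + h (v 2) = 0" "c + h (v 3) = 1"
    using bary_vertex[OF D, of 3 1] bary_vertex[OF D, of 3 2] bary_vertex[OF D, of 3 3]
    by (simp_all add: b)
  have "bary v 3 \<in> polys 1" unfolding polys_1_iff_affine using h b by blast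
  then have "cell_average (tri v) (bary v 3)
      = (\<Sum>i=1..3. w i / edge_length v i * edge_integral v i (bary v 3))
        + (\<Sum>s=1..S. \<omega> s * bary v 3 (\<xi> s))"
    using feas by (simp only: feasible_decomposition_def)
  moreover have "cell_average (tri v) (bary v 3) = 1/3"
    unfolding b cell_average_affine[OF D h] vert by simp
  moreover have "(\<Sum>s=1..S. \<omega> s * bary v 3 (\<xi> s)) \<ge> 0"
    using feas bary_nonneg_tri[OF D]
    by (intro sum_nonneg mult_nonneg_nonneg) (auto simp: feasible_decomposition_def less_imp_le)
  moreover have l: "0 < edge_length v 1" "0 < edge_length v 2"
    using edge_length_pos[OF D] by simp_all
  moreover have "(\<Sum>i=1..3. w i / edge_length v i * edge_integral v i (bary v 3)) = (w 1 + w 2) / 2"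
    unfolding b edge_integral_affine[OF h] sum_three
    using l by (simp add: vert add_divide_distrib del: One_nat_def)
  ultimately have w: "w 1 + w 2 \<le> 2/3" by simp
  define m where "m = Min ((\<lambda>i. w i / edge_length v i) ` {1..3})"
  have "m \<le> w i / edge_length v i" if "i \<in> {1..3}" for i
    unfolding m_def using that by (intro Min_le) auto
  then have "m \<le> w 1 / edge_length v 1" "m \<le> w 2 / edge_length v 2" by simp_all
  then have "m * edge_length v 1 \<le> w 1" "m * edge_length v 2 \<le> w 2"
    using l by (simp_all add: pos_le_divide_eq)
  then have "m * (3 * (edge_length v 1 + edge_length v 2)) \<le> 2"
    using w by (simp add: algebra_simps)
  then show ?thesis
    using l unfolding m_def[symmetric] cfl_const_def by (simp add: pos_le_divide_eq)
qed

section \<open>One step of the scheme\<close>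

definition edge_sum :: "(nat \<Rightarrow> real^2) \<Rightarrow> (nat \<Rightarrow> real) \<Rightarrow> (nat \<Rightarrow> nat \<Rightarrow> real) \<Rightarrow> real" where
  "edge_sum v \<omega> q = (\<Sum>i=1..3. edge_length v i * (\<Sum>\<nu>=1..2. \<omega> \<nu> * q i \<nu>))"

lemma edge_sum_add: "edge_sum v \<omega> (\<lambda>i \<nu>. p i \<nu> + q i \<nu>) = edge_sum v \<omega> p + edge_sum v \<omega> q"
  by (simp add: edge_sum_def distrib_left sum.distrib)

lemma edge_sum_diff: "edge_sum v \<omega> (\<lambda>i \<nu>. p i \<nu> - q i \<nu>) = edge_sum v \<omega> p - edge_sum v \<omega> q"
  by (simp add: edge_sum_def right_diff_distrib sum_subtractf)

lemma edge_sum_scale: "edge_sum v \<omega> (\<lambda>i \<nu>. c * q i \<nu>) = c * edge_sum v \<omega> q"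
  by (simp add: edge_sum_def sum_distrib_left mult.left_commute)

lemma edge_sum_edgewise:
  assumes "(\<Sum>\<nu>=1..2. \<omega> \<nu>) = 1"
  shows "edge_sum v \<omega> (\<lambda>i \<nu>. q i) = (\<Sum>i=1..3. edge_length v i * q i)"
  using assms by (simp add: edge_sum_def flip: sum_distrib_right)

lemma edge_sum_normal:
  assumes "tri_det v \<noteq> 0" "(\<Sum>\<nu>=1..2. \<omega> \<nu>) = 1"
  shows "edge_sum v \<omega> (\<lambda>i \<nu>. z \<bullet> outward_normal v i) = 0"
proof -
  have "(\<Sum>i=1..3. edge_length v i * (z \<bullet> outward_normal v i))
      = z \<bullet> (\<Sum>i=1..3. edge_length v i *\<^sub>R outward_normal v i)"
    by (simp add: inner_sum_right)
  then show ?thesis using sum_scaled_normals[OF assms(1)]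
    by (simp add: edge_sum_edgewise[OF assms(2)])
qed

lemma edge_sum_nonneg:
  assumes "tri_det v \<noteq> 0" "\<And>\<nu>. \<nu> \<in> {1..2} \<Longrightarrow> 0 < \<omega> \<nu>"
    and "\<And>i \<nu>. i \<in> {1..3} \<Longrightarrow> \<nu> \<in> {1..2} \<Longrightarrow> 0 \<le> q i \<nu>"
  shows "0 \<le> edge_sum v \<omega> q"
  unfolding edge_sum_def
  by (intro sum_nonneg mult_nonneg_nonneg) (use assms edge_length_pos[OF assms(1)] less_imp_le in blast)+

lemma edge_sum_pos:
  assumes "tri_det v \<noteq> 0" "\<And>\<nu>. \<nu> \<in> {1..2} \<Longrightarrow> 0 < \<omega> \<nu>"
    and "\<And>i \<nu>. i \<in> {1..3} \<Longrightarrow> \<nu> \<in> {1..2} \<Longrightarrow> 0 < q i \<nu>"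
  shows "0 < edge_sum v \<omega> q"
  unfolding edge_sum_def
  by (intro sum_pos mult_pos_pos) (use assms edge_length_pos[OF assms(1)] in \<open>auto simp del: One_nat_def\<close>)

text \<open>
  The margin in the inequality of the weak LF property at the state \<open>w\<close>, for the boundary point \<open>us\<close>
  with normal \<open>N\<close>, when \<open>\<alpha>\<close> is used as the viscosity coefficient.
\<close>

definition LF_excess where
  "LF_excess f1 f2 \<alpha> us N \<zeta> w n = \<alpha> * ((w - us) \<bullet> N) - flux_dot f1 f2 w n \<bullet> N - \<zeta> \<bullet> n"
  for \<zeta> n :: "real^2" and N :: "'u::euclidean_space"

text \<open>
  Up to the factor \<open>l\<^sub>i \<omega> \<nu>\<close>, the interior trace enters with the coefficient \<open>C - \<alpha> \<lambda> / 2\<close>,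
  where \<open>C\<close> is \<open>cfl_const (vtx K)\<close> and \<open>\<lambda> = dt / area K\<close>. The part
  \<open>\<alpha> \<lambda> / 2\<close> of it is used to dominate the interior flux, as the exterior trace with coefficient
  \<open>\<alpha> \<lambda> / 2\<close> dominates the exterior flux, and \<open>C - \<alpha> \<lambda>\<close> remains. The terms with \<open>\<zeta>\<close> may be inserted
  because they cancel when summed over the edges.
\<close>

lemma next_average_splitting:
  fixes u ub :: "(real^2) set \<Rightarrow> real^2 \<Rightarrow> 'u::euclidean_space" and \<zeta> :: "real^2"
    and T :: "(real^2) set set"
  assumes K: "K = tri (vtx K)" and D: "tri_det (vtx K) \<noteq> 0"
    and sorted: "edge_length (vtx K) 3 \<le> edge_length (vtx K) 2"
      "edge_length (vtx K) 2 \<le> edge_length (vtx K) 1"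
    and gauss: "gauss_rule 2 \<tau> \<omega>" and p: "u K \<in> polys 1"
  defines "n \<equiv> outward_normal (vtx K)"
    and "ui \<equiv> \<lambda>i \<nu>. int_trace u K (edge_path (vtx K) i (\<tau> \<nu>))"
    and "ue \<equiv> \<lambda>i \<nu>. ext_trace T vtx u ub K i (edge_path (vtx K) i (\<tau> \<nu>))"
  shows "(next_average T vtx 2 \<tau> \<omega> f1 f2 \<alpha> dt u ub K - us) \<bullet> N
    = (1 - (\<Sum>i=1..3. edge_weight (vtx K) i)) * ((star_value vtx 2 \<tau> \<omega> u K - us) \<bullet> N)
      + edge_sum (vtx K) \<omega> (\<lambda>i \<nu>.
          (cfl_const (vtx K) - \<alpha> * (dt / area K)) * ((ui i \<nu> - us) \<bullet> N)
          + (dt / (2 * area K)) * (LF_excess f1 f2 \<alpha> us N \<zeta> (ui i \<nu>) (n i)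
                                 + LF_excess f1 f2 \<alpha> us N \<zeta> (ue i \<nu>) (n i)))"
proof -
  let ?v = "vtx K" and ?star = "star_value vtx 2 \<tau> \<omega> u K"
  define W where "W = (\<Sum>i=1..3. edge_weight ?v i)"
  define S where "S = edge_sum ?v \<omega>"
  define \<mu> where "\<mu> = dt / (2 * area K)"
  have lam: "dt / area K = 2 * \<mu>" by (simp add: \<mu>_def)
  define C where "C = cfl_const ?v"
  define L where "L = (\<Sum>i=1..3. edge_length ?v i)"
  have WL: "W = C * L" unfolding W_def C_def L_def by (rule sum_edge_weight)
  have w: "edge_weight ?v i = C * edge_length ?v i" for i
    by (simp add: C_def edge_weight_def cfl_const_def)
  define fi fe where "fi i \<nu> = flux_dot f1 f2 (ui i \<nu>) (n i) \<bullet> N"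
    and "fe i \<nu> = flux_dot f1 f2 (ue i \<nu>) (n i) \<bullet> N" for i \<nu>
  define xi xe where "xi i \<nu> = ui i \<nu> \<bullet> N" and "xe i \<nu> = ue i \<nu> \<bullet> N" for i \<nu>
  have S1: "S (\<lambda>i \<nu>. c) = c * L" for c
    using gauss_2_sum[OF gauss] by (simp add: S_def edge_sum_edgewise L_def sum_distrib_left mult.commute)
  have S\<zeta>: "S (\<lambda>i \<nu>. \<zeta> \<bullet> n i) = 0"
    using edge_sum_normal[OF D gauss_2_sum[OF gauss]] by (simp add: S_def n_def)
  note S_lin = edge_sum_add[of ?v \<omega>, folded S_def] edge_sum_diff[of ?v \<omega>, folded S_def]
    edge_sum_scale[of ?v \<omega>, folded S_def] S1 S\<zeta>
  have avg: "cell_average K (u K) \<bullet> N = (1 - W) * (?star \<bullet> N) + C * S xi"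
  proof -
    have "cell_average K (u K) \<bullet> N = (1 - W) * (?star \<bullet> N)
        + (\<Sum>i=1..3. edge_weight ?v i * (\<Sum>\<nu>=1..2. \<omega> \<nu> * xi i \<nu>))"
      by (subst cell_average_splitting[where u = u and K = K and vtx = vtx and \<tau> = \<tau> and \<omega> = \<omega>,
            OF K D sorted gauss p])
        (simp add: inner_add_left inner_sum_left W_def xi_def ui_def)
    then show ?thesis by (simp add: w S_def edge_sum_def sum_distrib_left mult.assoc)
  qed
  have "next_average T vtx 2 \<tau> \<omega> f1 f2 \<alpha> dt u ub K \<bullet> N
      = cell_average K (u K) \<bullet> N - \<mu> * S (\<lambda>i \<nu>. fi i \<nu> + fe i \<nu> + \<alpha> * xi i \<nu> - \<alpha> * xe i \<nu>)"
    by (simp add: next_average_def Let_def S_def edge_sum_def inner_diff_left inner_add_left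
        inner_sum_left fi_def fe_def xi_def xe_def ui_def ue_def n_def \<mu>_def)
  then have "(next_average T vtx 2 \<tau> \<omega> f1 f2 \<alpha> dt u ub K - us) \<bullet> N
      = (1 - W) * (?star \<bullet> N) + C * S xi - \<mu> * (S fi + S fe + \<alpha> * S xi - \<alpha> * S xe) - us \<bullet> N"
    by (simp add: inner_diff_left avg S_lin)
  also have "\<dots> = (1 - W) * ((?star - us) \<bullet> N) + S (\<lambda>i \<nu>. (C - \<alpha> * (dt / area K)) * ((ui i \<nu> - us) \<bullet> N)
      + \<mu> * (LF_excess f1 f2 \<alpha> us N \<zeta> (ui i \<nu>) (n i) + LF_excess f1 f2 \<alpha> us N \<zeta> (ue i \<nu>) (n i)))"
    unfolding LF_excess_def inner_diff_left lam fi_def[symmetric] fe_def[symmetric]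
      xi_def[symmetric] xe_def[symmetric] S_lin WL
    by (simp add: algebra_simps)
  finally show ?thesis unfolding W_def C_def S_def \<mu>_def .
qed

text \<open>
  Strictness is inherited from the edge terms rather than from \<open>star_value\<close>, whose coefficient
  \<open>1 - W\<close> vanishes on equilateral triangles.
\<close>

lemma next_average_excess:
  fixes u ub :: "(real^2) set \<Rightarrow> real^2 \<Rightarrow> 'u::euclidean_space" and \<zeta> :: "real^2"
    and T :: "(real^2) set set"
  assumes K: "K = tri (vtx K)" and D: "tri_det (vtx K) \<noteq> 0"
    and sorted: "edge_length (vtx K) 3 \<le> edge_length (vtx K) 2"
      "edge_length (vtx K) 2 \<le> edge_length (vtx K) 1"
    and gauss: "gauss_rule 2 \<tau> \<omega>" and p: "u K \<in> polys 1"
    and dt: "dt > 0" and cfl: "\<alpha> * (dt / area K) \<le> cfl_const (vtx K)"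
    and traces: "\<And>i \<nu> w. i \<in> {1..3} \<Longrightarrow> \<nu> \<in> {1..2} \<Longrightarrow>
        w \<in> {int_trace u K (edge_path (vtx K) i (\<tau> \<nu>)),
             ext_trace T vtx u ub K i (edge_path (vtx K) i (\<tau> \<nu>))} \<Longrightarrow>
        0 \<le> (w - us) \<bullet> N \<and>
        succ_rel J j (LF_excess f1 f2 \<alpha> us N \<zeta> w (outward_normal (vtx K) i)) 0"
  shows "succ_rel J j ((next_average T vtx 2 \<tau> \<omega> f1 f2 \<alpha> dt u ub K - us) \<bullet> N)
    ((1 - (\<Sum>i=1..3. edge_weight (vtx K) i)) * ((star_value vtx 2 \<tau> \<omega> u K - us) \<bullet> N))"
proof -
  define ui ue where "ui i \<nu> = int_trace u K (edge_path (vtx K) i (\<tau> \<nu>))"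
    and "ue i \<nu> = ext_trace T vtx u ub K i (edge_path (vtx K) i (\<tau> \<nu>))" for i \<nu>
  let ?n = "outward_normal (vtx K)"
  let ?q = "\<lambda>i \<nu>. (cfl_const (vtx K) - \<alpha> * (dt / area K)) * ((ui i \<nu> - us) \<bullet> N)
          + (dt / (2 * area K)) * (LF_excess f1 f2 \<alpha> us N \<zeta> (ui i \<nu>) (?n i)
                                 + LF_excess f1 f2 \<alpha> us N \<zeta> (ue i \<nu>) (?n i))"
  have "0 < area K" using area_tri_pos[OF D] K by simp
  then have \<mu>: "0 < dt / (2 * area K)" using dt by simp
  have q: "succ_rel J j (?q i \<nu>) 0" if "i \<in> {1..3}" "\<nu> \<in> {1..2}" for i \<nu>
  proof -
    note t = traces[OF that, of "ui i \<nu>"] traces[OF that, of "ue i \<nu>"]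
    have "0 \<le> (cfl_const (vtx K) - \<alpha> * (dt / area K)) * ((ui i \<nu> - us) \<bullet> N)"
      using t(1) cfl by (intro mult_nonneg_nonneg) (auto simp: ui_def)
    moreover have "succ_rel J j (LF_excess f1 f2 \<alpha> us N \<zeta> (ui i \<nu>) (?n i)
        + LF_excess f1 f2 \<alpha> us N \<zeta> (ue i \<nu>) (?n i)) 0"
      using t by (auto simp: ui_def ue_def succ_rel_def split: if_splits)
    ultimately show ?thesis
      using \<mu> by (auto simp: succ_rel_def simp del: times_divide_eq_left times_divide_eq_right
          intro!: add_nonneg_pos add_nonneg_nonneg)
  qed
  have "succ_rel J j (edge_sum (vtx K) \<omega> ?q) 0"
  proof (cases "j \<in> J")
    case True
    then have "0 < ?q i \<nu>" if "i \<in> {1..3}" "\<nu> \<in> {1..2}" for i \<nu>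
      using q[OF that] by (simp add: succ_rel_def)
    from edge_sum_pos[OF D gauss_2_pos[OF gauss] this] True show ?thesis
      by (simp add: succ_rel_def)
  next
    case False
    then have "0 \<le> ?q i \<nu>" if "i \<in> {1..3}" "\<nu> \<in> {1..2}" for i \<nu>
      using q[OF that] by (simp add: succ_rel_def)
    from edge_sum_nonneg[OF D gauss_2_pos[OF gauss] this] False show ?thesis
      by (simp add: succ_rel_def)
  qed
  then show ?thesis
    unfolding next_average_splitting[where T = T and ub = ub and u = u and K = K and vtx = vtx
        and \<tau> = \<tau> and \<omega> = \<omega> and \<zeta> = \<zeta>,
        OF K D sorted gauss p, folded ui_def ue_def]
    by (simp add: succ_rel_def)
qed

section \<open>Systems\<close>

lemma sorted_mesh_cell:
  assumes "sorted_mesh \<Omega> T vtx" "K \<in> T"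
  shows "K = tri (vtx K)" "tri_det (vtx K) \<noteq> 0"
    "edge_length (vtx K) 3 \<le> edge_length (vtx K) 2" "edge_length (vtx K) 2 \<le> edge_length (vtx K) 1"
  using assms tri_det_nonzero unfolding sorted_mesh_def by blast+

lemma edge_weight_sum_bounds:
  assumes "sorted_mesh \<Omega> T vtx" "K \<in> T"
  shows "0 \<le> (\<Sum>i=1..3. edge_weight (vtx K) i)" "(\<Sum>i=1..3. edge_weight (vtx K) i) \<le> 1"
proof -
  note cell = sorted_mesh_cell[OF assms]
  show "0 \<le> (\<Sum>i=1..3. edge_weight (vtx K) i)"
    by (intro sum_nonneg) (simp add: edge_weight_def edge_length_def)
  show "(\<Sum>i=1..3. edge_weight (vtx K) i) \<le> 1"
    using edge_length_pos[OF cell(2), of 3] cell(3,4) by (intro sum_edge_weight_le_1) simp_all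
qed

lemma trace_edge_values:
  assumes "gauss_rule 2 \<tau> \<omega>" "\<nu> \<in> {1..2}"
    "w \<in> {int_trace u K (edge_path (vtx K) i (\<tau> \<nu>)),
           ext_trace T vtx u ub K i (edge_path (vtx K) i (\<tau> \<nu>))}"
  shows "w \<in> edge_values T vtx u ub K i"
  using edge_path_in_edge[OF gauss_2_node[OF assms(1,2)], of "vtx K" i] assms(3)
  by (auto simp: edge_values_def)

lemma alpha_wLF_upper:
  assumes "alpha_wLF T vtx G a u ub \<le> ereal \<alpha>" "K \<in> T" "i \<in> {1..3}"
    "w \<in> edge_values T vtx u ub K i" "w \<in> G"
  shows "a w (outward_normal (vtx K) i) \<le> \<alpha>"
proof -
  have "ereal (a w (outward_normal (vtx K) i)) \<le> alpha_wLF T vtx G a u ub"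
    unfolding alpha_wLF_def
    by (rule SUP_upper2[OF assms(2)], rule SUP_upper2[OF assms(3)], rule SUP_upper)
      (use assms(4,5) in blast)
  from order_trans[OF this assms(1)] show ?thesis by simp
qed

lemma gql_inner_nonneg:
  assumes "w \<in> gql_region J Jh g" "j \<in> J \<union> Jh" "us \<in> boundary_part J Jh g j"
  shows "succ_rel J j ((w - us) \<bullet> gradient (g j) us) 0" "0 \<le> (w - us) \<bullet> gradient (g j) us"
proof -
  show "succ_rel J j ((w - us) \<bullet> gradient (g j) us) 0"
    using assms unfolding gql_region_def by blast
  then show "0 \<le> (w - us) \<bullet> gradient (g j) us"
    by (auto simp: succ_rel_def split: if_splits)
qed

text \<open>
  Increasing the coefficient from \<open>a w n\<close> to \<open>\<alpha>\<close> preserves the weak LF inequality since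
  \<open>(w - us) \<bullet> N\<close> is nonnegative on the region.
\<close>

lemma system_bound_preserving:
  fixes u ub :: "(real^2) set \<Rightarrow> real^2 \<Rightarrow> 'u::euclidean_space"
  assumes mesh: "sorted_mesh \<Omega> T vtx" and gauss: "gauss_rule 2 \<tau> \<omega>"
    and gql: "region J Jh g = gql_region J Jh g"
    and wLF: "weak_LF J Jh g f1 f2 a \<zeta>"
    and p: "\<forall>K\<in>T. u K \<in> polys 1"
    and adm: "solution_admissible T vtx 2 \<tau> \<omega> (region J Jh g) u ub"
    and \<alpha>: "alpha_wLF T vtx (region J Jh g) a u ub \<le> ereal \<alpha>"
    and dt: "dt > 0" and cfl: "\<alpha> * (dt / area K) \<le> cfl_const (vtx K)" and K: "K \<in> T"
  shows "next_average T vtx 2 \<tau> \<omega> f1 f2 \<alpha> dt u ub K \<in> region J Jh g"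
proof -
  let ?G = "region J Jh g" and ?W = "\<Sum>i=1..3. edge_weight (vtx K) i"
  note cell = sorted_mesh_cell[OF mesh K]
  have "succ_rel J j ((next_average T vtx 2 \<tau> \<omega> f1 f2 \<alpha> dt u ub K - us) \<bullet> gradient (g j) us) 0"
    if j: "j \<in> J \<union> Jh" and us: "us \<in> boundary_part J Jh g j" for j us
  proof -
    define N where "N = gradient (g j) us"
    have "0 \<le> (w - us) \<bullet> N \<and>
        succ_rel J j (LF_excess f1 f2 \<alpha> us N (\<zeta> us) w (outward_normal (vtx K) i)) 0"
      if i: "i \<in> {1..3}" and \<nu>: "\<nu> \<in> {1..2}"
        and w: "w \<in> {int_trace u K (edge_path (vtx K) i (\<tau> \<nu>)),
             ext_trace T vtx u ub K i (edge_path (vtx K) i (\<tau> \<nu>))}" for i \<nu> w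
    proof -
      define n where "n = outward_normal (vtx K) i"
      have G: "w \<in> ?G" using adm K i \<nu> w unfolding solution_admissible_def by blast
      then have nonneg: "0 \<le> (w - us) \<bullet> N"
        using gql_inner_nonneg(2)[OF _ j us] gql unfolding N_def by blast
      have "a w n \<le> \<alpha>"
        unfolding n_def by (rule alpha_wLF_upper[OF \<alpha> K i trace_edge_values[OF gauss \<nu> w] G])
      then have "a w n * ((w - us) \<bullet> N) \<le> \<alpha> * ((w - us) \<bullet> N)"
        using nonneg by (rule mult_right_mono)
      moreover have "succ_rel J j (a w n * ((w - us) \<bullet> N) - flux_dot f1 f2 w n \<bullet> N) (\<zeta> us \<bullet> n)"
        using wLF G j us norm_outward_normal[OF cell(2) i] unfolding weak_LF_def n_def N_def by blast
      ultimately show ?thesis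
        using nonneg by (auto simp: succ_rel_def LF_excess_def n_def split: if_splits)
    qed
    then have "succ_rel J j ((next_average T vtx 2 \<tau> \<omega> f1 f2 \<alpha> dt u ub K - us) \<bullet> N)
        ((1 - ?W) * ((star_value vtx 2 \<tau> \<omega> u K - us) \<bullet> N))"
      by (intro next_average_excess[where u = u and K = K and vtx = vtx, OF cell gauss bspec[OF p K] dt cfl]) blast+
    moreover have "0 \<le> (1 - ?W) * ((star_value vtx 2 \<tau> \<omega> u K - us) \<bullet> N)"
    proof (cases "?W = 1")
      case False
      then have "star_value vtx 2 \<tau> \<omega> u K \<in> ?G"
        using adm K unfolding solution_admissible_def by blast
      then have "0 \<le> (star_value vtx 2 \<tau> \<omega> u K - us) \<bullet> N"
        using gql_inner_nonneg(2)[OF _ j us] gql unfolding N_def by blast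
      then show ?thesis using edge_weight_sum_bounds(2)[OF mesh K] by simp
    qed simp
    ultimately show ?thesis by (auto simp: succ_rel_def N_def split: if_splits)
  qed
  then show ?thesis unfolding gql unfolding gql_region_def by blast
qed

section \<open>Scalar conservation laws\<close>

lemma alpha_LF_upper:
  assumes "alpha_LF T vtx f1 f2 u ub \<le> ereal \<alpha>" "K \<in> T" "i \<in> {1..3}"
    "w \<in> convex hull (\<Union>m\<in>{1..3}. edge_values T vtx u ub K m)"
  shows "\<bar>flux_dot (deriv f1) (deriv f2) w (outward_normal (vtx K) i)\<bar> \<le> \<alpha>"
proof -
  have "ereal \<bar>flux_dot (deriv f1) (deriv f2) w (outward_normal (vtx K) i)\<bar>
      \<le> alpha_LF T vtx f1 f2 u ub"
    unfolding alpha_LF_def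
    by (rule SUP_upper2[OF assms(2)], rule SUP_upper2[OF assms(3)], rule SUP_upper[OF assms(4)])
  from order_trans[OF this assms(1)] show ?thesis by simp
qed

lemma flux_dot_lipschitz:
  fixes f1 f2 :: "real \<Rightarrow> real"
  assumes diff: "\<And>v. f1 differentiable (at v) \<and> f2 differentiable (at v)"
    and "convex H" "x \<in> H" "y \<in> H"
    and bound: "\<And>v. v \<in> H \<Longrightarrow> \<bar>flux_dot (deriv f1) (deriv f2) v n\<bar> \<le> \<alpha>"
  shows "\<bar>flux_dot f1 f2 x n - flux_dot f1 f2 y n\<bar> \<le> \<alpha> * \<bar>x - y\<bar>"
proof -
  have "((\<lambda>v. flux_dot f1 f2 v n) has_field_derivative flux_dot (deriv f1) (deriv f2) v n)
      (at v within H)" for v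
  proof -
    have "(f1 has_field_derivative deriv f1 v) (at v within H)"
      "(f2 has_field_derivative deriv f2 v) (at v within H)"
      using diff[of v] by (simp_all add: DERIV_deriv_iff_real_differentiable has_field_derivative_at_within)
    then show ?thesis unfolding flux_dot_def by (auto intro!: derivative_eq_intros)
  qed
  from field_differentiable_bound[OF assms(2) this _ assms(4,3)] bound
  show ?thesis by (simp add: abs_minus_commute)
qed

text \<open>
  The reference state is an extremal trace \<open>m\<close> and not the end point of the invariant interval: the
  Lipschitz constant \<open>\<alpha>\<close> of the normal flux is available only on the convex hull of the traces, which
  need not contain that end point. With \<open>\<zeta> \<bullet> n = - N (F(m) \<bullet> n)\<close>, the weak LF inequality becomes the
  Lipschitz estimate between \<open>w\<close> and \<open>m\<close>.
\<close>

lemma scalar_next_average_excess: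
  fixes u ub :: "(real^2) set \<Rightarrow> real^2 \<Rightarrow> real"
  assumes mesh: "sorted_mesh \<Omega> T vtx" and gauss: "gauss_rule 2 \<tau> \<omega>"
    and diff: "\<And>v. f1 differentiable (at v) \<and> f2 differentiable (at v)"
    and p: "u K \<in> polys 1"
    and \<alpha>: "alpha_LF T vtx f1 f2 u ub \<le> ereal \<alpha>"
    and dt: "dt > 0" and cfl: "\<alpha> * (dt / area K) \<le> cfl_const (vtx K)" and K: "K \<in> T"
    and V: "V = (\<Union>i\<in>{1..3}. \<Union>\<nu>\<in>{1..2}. {int_trace u K (edge_path (vtx K) i (\<tau> \<nu>)),
             ext_trace T vtx u ub K i (edge_path (vtx K) i (\<tau> \<nu>))})"
    and m: "m \<in> V" and extremal: "\<And>w. w \<in> V \<Longrightarrow> 0 \<le> (w - m) * N" and N: "\<bar>N\<bar> = 1"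
  shows "(1 - (\<Sum>i=1..3. edge_weight (vtx K) i)) * ((star_value vtx 2 \<tau> \<omega> u K - m) * N)
    \<le> (next_average T vtx 2 \<tau> \<omega> f1 f2 \<alpha> dt u ub K - m) * N"
proof -
  note cell = sorted_mesh_cell[OF mesh K]
  let ?H = "convex hull (\<Union>m\<in>{1..3}. edge_values T vtx u ub K m)"
  define \<zeta> :: "real^2" where "\<zeta> = vector [- (f1 m * N), - (f2 m * N)]"
  have \<zeta>: "\<zeta> \<bullet> n = - (flux_dot f1 f2 m n * N)" for n
    by (simp add: \<zeta>_def inner_vec_def sum_2 flux_dot_def algebra_simps)
  have VH: "V \<subseteq> ?H"
  proof
    fix w assume "w \<in> V"
    then obtain i \<nu> where i: "i \<in> {1..3}" and "\<nu> \<in> {1..2}"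
      and "w \<in> {int_trace u K (edge_path (vtx K) i (\<tau> \<nu>)),
             ext_trace T vtx u ub K i (edge_path (vtx K) i (\<tau> \<nu>))}"
      unfolding V by blast
    from trace_edge_values[OF gauss this(2,3)] i show "w \<in> ?H"
      by (intro hull_inc) blast
  qed
  \<comment> \<open>For the empty index set, \<open>succ_rel\<close> is the weak inequality.\<close>
  have "0 \<le> (w - m) \<bullet> N \<and>
      succ_rel {} () (LF_excess f1 f2 \<alpha> m N \<zeta> w (outward_normal (vtx K) i)) 0"
    if i: "i \<in> {1..3}" and \<nu>: "\<nu> \<in> {1..2}"
      and w: "w \<in> {int_trace u K (edge_path (vtx K) i (\<tau> \<nu>)),
           ext_trace T vtx u ub K i (edge_path (vtx K) i (\<tau> \<nu>))}" for i \<nu> w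
  proof -
    let ?n = "outward_normal (vtx K) i"
    have "w \<in> V" unfolding V using that by blast
    then have nonneg: "0 \<le> (w - m) * N" by (rule extremal)
    have "\<bar>flux_dot f1 f2 w ?n - flux_dot f1 f2 m ?n\<bar> \<le> \<alpha> * \<bar>w - m\<bar>"
      using VH \<open>w \<in> V\<close> m alpha_LF_upper[OF \<alpha> K i]
      by (intro flux_dot_lipschitz[OF diff convex_convex_hull]) blast+
    also have "\<bar>w - m\<bar> = (w - m) * N"
      using abs_of_nonneg[OF nonneg] N by (simp add: abs_mult)
    finally have "(flux_dot f1 f2 w ?n - flux_dot f1 f2 m ?n) * N \<le> \<alpha> * ((w - m) * N)"
      using N by (metis abs_ge_self abs_mult mult.right_neutral order_trans)
    then show ?thesis
      using nonneg by (simp add: succ_rel_def LF_excess_def \<zeta> algebra_simps)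
  qed
  then have "succ_rel {} () ((next_average T vtx 2 \<tau> \<omega> f1 f2 \<alpha> dt u ub K - m) \<bullet> N)
      ((1 - (\<Sum>i=1..3. edge_weight (vtx K) i)) * ((star_value vtx 2 \<tau> \<omega> u K - m) \<bullet> N))"
    by (intro next_average_excess[where u = u and K = K and vtx = vtx, OF cell gauss p dt cfl]) blast+
  then show ?thesis by (simp add: succ_rel_def)
qed

text \<open>
  The new average lies between the two convex combinations of an extremal trace, with weight \<open>W\<close>, and
  of \<open>star_value\<close>, with weight \<open>1 - W\<close>.
\<close>

lemma scalar_bound_preserving:
  fixes u ub :: "(real^2) set \<Rightarrow> real^2 \<Rightarrow> real"
  assumes mesh: "sorted_mesh \<Omega> T vtx" and gauss: "gauss_rule 2 \<tau> \<omega>"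
    and diff: "\<And>v. f1 differentiable (at v) \<and> f2 differentiable (at v)"
    and p: "\<forall>K\<in>T. u K \<in> polys 1"
    and adm: "solution_admissible T vtx 2 \<tau> \<omega> {lo..hi} u ub"
    and \<alpha>: "alpha_LF T vtx f1 f2 u ub \<le> ereal \<alpha>"
    and dt: "dt > 0" and cfl: "\<alpha> * (dt / area K) \<le> cfl_const (vtx K)" and K: "K \<in> T"
  shows "next_average T vtx 2 \<tau> \<omega> f1 f2 \<alpha> dt u ub K \<in> {lo..hi}"
proof -
  define V where "V = (\<Union>i\<in>{1..3}. \<Union>\<nu>\<in>{1..2}. {int_trace u K (edge_path (vtx K) i (\<tau> \<nu>)),
             ext_trace T vtx u ub K i (edge_path (vtx K) i (\<tau> \<nu>))})"
  define W where "W = (\<Sum>i=1..3. edge_weight (vtx K) i)"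
  let ?star = "star_value vtx 2 \<tau> \<omega> u K" and ?next = "next_average T vtx 2 \<tau> \<omega> f1 f2 \<alpha> dt u ub K"
  have V: "finite V" "V \<noteq> {}" "V \<subseteq> {lo..hi}"
    using adm K unfolding V_def solution_admissible_def by (simp, force, blast)
  have W: "0 \<le> W" "W \<le> 1" using edge_weight_sum_bounds[OF mesh K] by (simp_all add: W_def)
  have star: "W = 1 \<or> ?star \<in> {lo..hi}"
    using adm K unfolding W_def solution_admissible_def by blast
  note step = scalar_next_average_excess[OF mesh gauss diff bspec[OF p K] \<alpha> dt cfl K V_def,
      folded W_def]
  have "(1 - W) * (?star - Min V) \<le> ?next - Min V"
    using step[OF Min_in[OF V(1,2)], of 1] V(1) by simp
  moreover have "(1 - W) * (Max V - ?star) \<le> Max V - ?next"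
    using step[OF Max_in[OF V(1,2)], of "-1"] V(1) by simp
  ultimately have lower: "W * Min V + (1 - W) * ?star \<le> ?next"
    and upper: "?next \<le> W * Max V + (1 - W) * ?star"
    by (simp_all add: algebra_simps)
  have "lo \<le> Min V" "Max V \<le> hi" using Min_in[OF V(1,2)] Max_in[OF V(1,2)] V(3) by auto
  then have "W * lo \<le> W * Min V" "W * Max V \<le> W * hi" using W(1) by (simp_all add: mult_left_mono)
  moreover have "(1 - W) * lo \<le> (1 - W) * ?star" "(1 - W) * ?star \<le> (1 - W) * hi"
    using star W(2) by (auto intro: mult_left_mono)
  ultimately have "W * lo + (1 - W) * lo \<le> ?next" "?next \<le> W * hi + (1 - W) * hi"
    using lower upper by linarith+
  then show ?thesis by (simp add: algebra_simps)
qed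

theorem corollary4p1:
  fixes \<Omega> :: "(real^2) set" and T :: "(real^2) set set"
    and vtx :: "(real^2) set \<Rightarrow> nat \<Rightarrow> real^2" and \<tau> \<omega> :: "nat \<Rightarrow> real"
  assumes "open \<Omega>" and "\<Omega> \<noteq> {}"
    and mesh: "sorted_mesh \<Omega> T vtx"
    and gauss: "gauss_rule 2 \<tau> \<omega>"
  shows
    "(\<forall>(J :: 'j set) Jh (g :: 'j \<Rightarrow> real^'d \<Rightarrow> real) f1 f2 a \<zeta> u ub \<alpha> dt.
        J \<inter> Jh = {} \<longrightarrow>
        (\<forall>j\<in>J \<union> Jh. \<forall>us\<in>boundary_part J Jh g j. g j differentiable (at us)) \<longrightarrow>
        region J Jh g = gql_region J Jh g \<longrightarrow>
        hyperbolic_on (region J Jh g) f1 f2 \<longrightarrow>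
        weak_LF J Jh g f1 f2 a \<zeta> \<longrightarrow>
        (\<forall>K\<in>T. u K \<in> polys 1) \<longrightarrow>
        solution_admissible T vtx 2 \<tau> \<omega> (region J Jh g) u ub \<longrightarrow>
        ereal \<alpha> \<ge> alpha_wLF T vtx (region J Jh g) a u ub \<longrightarrow>
        dt > 0 \<longrightarrow>
        (\<forall>K\<in>T. \<alpha> * (dt / area K) \<le> cfl_const (vtx K)) \<longrightarrow>
        (\<forall>K\<in>T. next_average T vtx 2 \<tau> \<omega> f1 f2 \<alpha> dt u ub K \<in> region J Jh g))
     \<and>
     (\<forall>(u0 :: real^2 \<Rightarrow> real) umin umax f1 f2 u ub \<alpha> dt.
        bounded (u0 ` \<Omega>) \<longrightarrow> umin = Inf (u0 ` \<Omega>) \<longrightarrow> umax = Sup (u0 ` \<Omega>) \<longrightarrow>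
        (\<forall>v. f1 differentiable (at v) \<and> f2 differentiable (at v)) \<longrightarrow>
        (\<forall>K\<in>T. u K \<in> polys 1) \<longrightarrow>
        solution_admissible T vtx 2 \<tau> \<omega> {umin..umax} u ub \<longrightarrow>
        ereal \<alpha> \<ge> alpha_LF T vtx f1 f2 u ub \<longrightarrow>
        dt > 0 \<longrightarrow>
        (\<forall>K\<in>T. \<alpha> * (dt / area K) \<le> cfl_const (vtx K)) \<longrightarrow>
        (\<forall>K\<in>T. next_average T vtx 2 \<tau> \<omega> f1 f2 \<alpha> dt u ub K \<in> {umin..umax}))
     \<and>
     (\<forall>K\<in>T. \<forall>w S \<omega>' \<xi>. feasible_decomposition 1 (vtx K) w S \<omega>' \<xi> \<longrightarrow>
        Min ((\<lambda>i. w i / edge_length (vtx K) i) ` {1..3}) \<le> cfl_const (vtx K))"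
proof (intro conjI allI impI ballI)
  show "next_average T vtx 2 \<tau> \<omega> f1 f2 \<alpha> dt u ub K \<in> region J Jh g"
    if "region J Jh g = gql_region J Jh g" "weak_LF J Jh g f1 f2 a \<zeta>" "\<forall>K\<in>T. u K \<in> polys 1"
      "solution_admissible T vtx 2 \<tau> \<omega> (region J Jh g) u ub"
      "alpha_wLF T vtx (region J Jh g) a u ub \<le> ereal \<alpha>" "dt > 0"
      "\<forall>K\<in>T. \<alpha> * (dt / area K) \<le> cfl_const (vtx K)" "K \<in> T"
    for J Jh and g :: "'j \<Rightarrow> real^'d \<Rightarrow> real" and f1 f2 a \<zeta> u ub \<alpha> dt K
    using that system_bound_preserving[OF mesh gauss] by blast
  show "next_average T vtx 2 \<tau> \<omega> f1 f2 \<alpha> dt u ub K \<in> {umin..umax}"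
    if "\<forall>v. f1 differentiable (at v) \<and> f2 differentiable (at v)" "\<forall>K\<in>T. u K \<in> polys 1"
      "solution_admissible T vtx 2 \<tau> \<omega> {umin..umax} u ub"
      "alpha_LF T vtx f1 f2 u ub \<le> ereal \<alpha>" "dt > 0"
      "\<forall>K\<in>T. \<alpha> * (dt / area K) \<le> cfl_const (vtx K)" "K \<in> T"
    for umin umax :: real and f1 f2 u ub \<alpha> dt K
    using that scalar_bound_preserving[OF mesh gauss] by blast
  show "Min ((\<lambda>i. w i / edge_length (vtx K) i) ` {1..3}) \<le> cfl_const (vtx K)"
    if "K \<in> T" "feasible_decomposition 1 (vtx K) w S \<omega>' \<xi>" for K w S \<omega>' \<xi>
    using feasible_decomposition_bound[OF sorted_mesh_cell(2)[OF mesh that(1)] that(2)] .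
qed

end
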